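(* Let $\kappa>0$ and $T>0$. Assume that $f,g:\mathbb{T}\times[0,T]\to\mathbb{R}$ are respectively a bounded viscosity subsolution and a bounded viscosity supersolution of $\partial_tf=-\kappa G(f)f$ on $(0,T)$. If $f(x,0)\le g(x,0)$ for all $x\in\mathbb{T}$, then $f(x,t)\le g(x,t)$ for all $(x,t)\in\mathbb{T}\times[0,T]$.
   Context: $\mathbb{T}=\mathbb{R}/2\pi\mathbb{Z}$. Dirichlet-Neumann operator. For Lipschitz $f:\mathbb{T}\to\mathbb{R}$ let $\Omega_f=\{(x,y)\in\mathbb{T}\times\mathbb{R}:y<f(x)\}$ and $N(x)=(-\partial_xf(x),1)$. For $g:\mathbb{T}\to\mathbb{R}$ let $\phi$ be the harmonic extension of $g$ to $\Omega_f$: the unique function with $\nabla\phi\in L^2(\Omega_f)$, trace $\phi(x,f(x))=g(x)$ and $\Delta\phi=0$ in $\Omega_f$ (in the variational sense). Then $$(G(f)g)(x)=\lim_{h\to0^-}\frac1h\big[\phi((x,f(x))+hN(x))-\phi(x,f(x))\big],$$ and for time-dependent $f,g$, $(G(f)g)(x,t)=(G(f(t))g(t))(x)$. Viscosity solutions. A function $f:\mathbb{T}\times[0,T]\to\mathbb{R}$ is a viscosity subsolution (resp. supersolution) of $\partial_tf=-\kappa G(f)f$ on $(0,T)$ if (i) $f$ is upper semicontinuous (resp. lower semicontinuous) on $\mathbb{T}\times[0,T]$, and (ii) for every $\psi:\mathbb{T}\times(0,T)\to\mathbb{R}$ with $\partial_t\psi\in C(\mathbb{T}\times(0,T))$ and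 $\psi\in C((0,T);C^{1,1}(\mathbb{T}))$, if $f-\psi$ attains a global maximum (resp. minimum) over $\mathbb{T}\times[t_0-r,t_0]$ at $(x_0,t_0)\in\mathbb{T}\times(0,T)$ for some $r>0$, then $\partial_t\psi(x_0,t_0)\le-\kappa(G(\psi)\psi)(x_0,t_0)$ (resp. $\ge$).
   Formalization: At t=T the claim is false as stated (f=0 for t<T, f(·,T)=1, g=0), so f(x,T)≤g(x,T) is proved only at x where f(x,T) is at most the limsup, and g(x,T) at least the liminf, of values at earlier times near (x,T); for t<T it is unconditional. *)

theory Defs
  imports "HOL-Analysis.Analysis"
begin

text \<open>
  The torus is the real line modulo 2 pi. Functions on it are 2 pi-periodic functions on the
  line, and functions on the cylinder (torus times line) are functions on the plane that are
  2 pi-periodic in the first variable. Integrals over the torus or the cylinder are integrals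
  over one period.
\<close>

definition periodic :: "(real \<Rightarrow> 'a) \<Rightarrow> bool" where
  "periodic u \<longleftrightarrow> (\<forall>x. u (x + 2 * pi) = u x)"

definition periodic_fst :: "(real \<times> real \<Rightarrow> 'a) \<Rightarrow> bool" where
  "periodic_fst u \<longleftrightarrow> (\<forall>x y. u (x + 2 * pi, y) = u (x, y))"


section \<open>Square integrable functions\<close>

definition L2_on :: "'a::euclidean_space set \<Rightarrow> ('a \<Rightarrow> 'b::euclidean_space) \<Rightarrow> bool" where
  "L2_on A u \<longleftrightarrow> set_borel_measurable lebesgue A u \<and>
     set_integrable lebesgue A (\<lambda>p. (norm (u p))\<^sup>2)"

definition L2_tendsto ::
    "'a::euclidean_space set \<Rightarrow> (nat \<Rightarrow> 'a \<Rightarrow> 'b::euclidean_space) \<Rightarrow> ('a \<Rightarrow> 'b) \<Rightarrow> bool" where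
  "L2_tendsto A w u \<longleftrightarrow> (\<forall>n. L2_on A (w n)) \<and> L2_on A u \<and>
     (\<lambda>n. LINT p:A|lebesgue. (norm (w n p - u p))\<^sup>2) \<longlonglongrightarrow> 0"


section \<open>The Dirichlet-Neumann operator\<close>

definition subgraph :: "(real \<Rightarrow> real) \<Rightarrow> (real \<times> real) set" where
  "subgraph f = {(x, y). y < f x}"

definition subgraph_cell :: "(real \<Rightarrow> real) \<Rightarrow> (real \<times> real) set" where
  "subgraph_cell f = {(x, y). 0 \<le> x \<and> x < 2 * pi \<and> y < f x}"

text \<open>Continuously differentiable functions \<open>\<eta>\<close> on the cylinder, with gradient \<open>D\<close>.\<close>

definition C1_grad :: "(real \<times> real \<Rightarrow> real) \<Rightarrow> (real \<times> real \<Rightarrow> real \<times> real) \<Rightarrow> bool" where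
  "C1_grad \<eta> D \<longleftrightarrow> periodic_fst \<eta> \<and> (\<forall>p. GDERIV \<eta> p :> D p) \<and> continuous_on UNIV D"

text \<open>The support is compact in the cylinder, so only its part in one closed period has to lie
  in a compact subset of the plane.\<close>

definition C1_test ::
    "(real \<Rightarrow> real) \<Rightarrow> (real \<times> real \<Rightarrow> real) \<Rightarrow> (real \<times> real \<Rightarrow> real \<times> real) \<Rightarrow> bool" where
  "C1_test f \<eta> D \<longleftrightarrow> C1_grad \<eta> D \<and>
     (\<exists>K. compact K \<and> K \<subseteq> subgraph f \<and>
        (\<forall>x y. 0 \<le> x \<and> x \<le> 2 * pi \<and> \<eta> (x, y) \<noteq> 0 \<longrightarrow> (x, y) \<in> K))"

definition weak_gradient ::
    "(real \<Rightarrow> real) \<Rightarrow> (real \<times> real \<Rightarrow> real) \<Rightarrow> (real \<times> real \<Rightarrow> real \<times> real) \<Rightarrow> bool" where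
  "weak_gradient f \<phi> V \<longleftrightarrow> periodic_fst V \<and>
     (\<forall>\<eta> D. C1_test f \<eta> D \<longrightarrow>
        (LINT p:subgraph_cell f|lebesgue. \<phi> p *\<^sub>R D p) =
        - (LINT p:subgraph_cell f|lebesgue. \<eta> p *\<^sub>R V p))"

text \<open>
  The Sobolev trace on the graph: \<open>g\<close> is the limit of the restrictions to the graph of functions
  that are continuously differentiable up to the boundary and converge to \<open>\<phi>\<close> in
  H1. As only the gradient of \<open>\<phi>\<close> is square integrable on the whole domain, the
  convergence in H1 is required on every part of the domain of bounded depth.
\<close>

definition has_trace ::
    "(real \<Rightarrow> real) \<Rightarrow> (real \<times> real \<Rightarrow> real) \<Rightarrow> (real \<times> real \<Rightarrow> real \<times> real) \<Rightarrow>
     (real \<Rightarrow> real) \<Rightarrow> bool" where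
  "has_trace f \<phi> V g \<longleftrightarrow>
     (\<exists>w D. (\<forall>n. C1_grad (w n) (D n)) \<and>
        (\<forall>m. L2_tendsto (subgraph_cell f \<inter> {p. m < snd p}) w \<phi> \<and>
             L2_tendsto (subgraph_cell f \<inter> {p. m < snd p}) D V) \<and>
        L2_tendsto {0..<2 * pi} (\<lambda>n x. w n (x, f x)) g)"

text \<open>
  A weakly harmonic function is smooth in the open domain after a change on a null set; the
  pointwise values used in the Dirichlet-Neumann operator are those of this continuous
  representative in the domain and those of the trace on the graph. For Lipschitz \<open>f\<close>
  these conditions determine \<open>\<phi>\<close> on the closed domain; its values above the graph are
  arbitrary.
\<close>

definition harmonic_extension ::
    "(real \<Rightarrow> real) \<Rightarrow> (real \<Rightarrow> real) \<Rightarrow> (real \<times> real \<Rightarrow> real) \<Rightarrow> bool" where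
  "harmonic_extension f g \<phi> \<longleftrightarrow>
     periodic_fst \<phi> \<and> continuous_on (subgraph f) \<phi> \<and> (\<forall>x. \<phi> (x, f x) = g x) \<and>
     (\<exists>V. weak_gradient f \<phi> V \<and> L2_on (subgraph_cell f) V \<and> has_trace f \<phi> V g \<and>
        (\<forall>\<eta> D. C1_test f \<eta> D \<longrightarrow> (LINT p:subgraph_cell f|lebesgue. V p \<bullet> D p) = 0))"

definition normal_vec :: "(real \<Rightarrow> real) \<Rightarrow> real \<Rightarrow> real \<times> real" where
  "normal_vec f x = (- deriv f x, 1)"

text \<open>The number defined here is the limit in the definition of the operator; it does not depend on
  the choice of \<open>\<phi>\<close> because the points involved lie in the closed domain.\<close>

definition dirichlet_neumann :: "(real \<Rightarrow> real) \<Rightarrow> (real \<Rightarrow> real) \<Rightarrow> real \<Rightarrow> real" where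
  "dirichlet_neumann f g x =
     (THE l. \<exists>\<phi>. harmonic_extension f g \<phi> \<and>
        ((\<lambda>h. (\<phi> ((x, f x) + h *\<^sub>R normal_vec f x) - \<phi> (x, f x)) / h) \<longlongrightarrow> l) (at_left 0))"


section \<open>Viscosity solutions\<close>

definition usc_on :: "'a::topological_space set \<Rightarrow> ('a \<Rightarrow> real) \<Rightarrow> bool" where
  "usc_on A F \<longleftrightarrow> (\<forall>p\<in>A. \<forall>c. F p < c \<longrightarrow> eventually (\<lambda>q. F q < c) (at p within A))"

definition lsc_on :: "'a::topological_space set \<Rightarrow> ('a \<Rightarrow> real) \<Rightarrow> bool" where
  "lsc_on A F \<longleftrightarrow> (\<forall>p\<in>A. \<forall>c. c < F p \<longrightarrow> eventually (\<lambda>q. c < F q) (at p within A))"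

definition C11 :: "(real \<Rightarrow> real) \<Rightarrow> bool" where
  "C11 u \<longleftrightarrow> periodic u \<and> (\<forall>x. u differentiable (at x)) \<and> (\<exists>L. L-lipschitz_on UNIV (deriv u))"

definition C11_norm :: "(real \<Rightarrow> real) \<Rightarrow> real" where
  "C11_norm u = (SUP x. \<bar>u x\<bar>) + (SUP x. \<bar>deriv u x\<bar>) +
     Sup {\<bar>deriv u x - deriv u y\<bar> / \<bar>x - y\<bar> | x y. x \<noteq> y}"

text \<open>Only the values of \<open>\<psi> x t\<close> with \<open>0 < t < T\<close> matter.\<close>

definition test_function :: "real \<Rightarrow> (real \<Rightarrow> real \<Rightarrow> real) \<Rightarrow> bool" where
  "test_function T \<psi> \<longleftrightarrow>
     (\<forall>x. \<forall>t\<in>{0<..<T}. \<psi> x differentiable (at t)) \<and>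
     continuous_on (UNIV \<times> {0<..<T}) (\<lambda>(x, t). deriv (\<psi> x) t) \<and>
     (\<forall>t\<in>{0<..<T}. C11 (\<lambda>x. \<psi> x t)) \<and>
     (\<forall>s\<in>{0<..<T}. ((\<lambda>t. C11_norm (\<lambda>x. \<psi> x t - \<psi> x s)) \<longlongrightarrow> 0) (at s))"

text \<open>The condition \<open>r < s\<close> keeps the time interval inside the domain of the test function.\<close>

definition viscosity_subsolution :: "real \<Rightarrow> real \<Rightarrow> (real \<Rightarrow> real \<Rightarrow> real) \<Rightarrow> bool" where
  "viscosity_subsolution \<kappa> T f \<longleftrightarrow>
     (\<forall>t\<in>{0..T}. periodic (\<lambda>x. f x t)) \<and>
     usc_on (UNIV \<times> {0..T}) (\<lambda>(x, t). f x t) \<and>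
     (\<forall>\<psi> z s r. test_function T \<psi> \<and> 0 < s \<and> s < T \<and> 0 < r \<and> r < s \<and>
        (\<forall>x. \<forall>t\<in>{s - r..s}. f x t - \<psi> x t \<le> f z s - \<psi> z s) \<longrightarrow>
        deriv (\<psi> z) s \<le> - \<kappa> * dirichlet_neumann (\<lambda>x. \<psi> x s) (\<lambda>x. \<psi> x s) z)"

definition viscosity_supersolution :: "real \<Rightarrow> real \<Rightarrow> (real \<Rightarrow> real \<Rightarrow> real) \<Rightarrow> bool" where
  "viscosity_supersolution \<kappa> T f \<longleftrightarrow>
     (\<forall>t\<in>{0..T}. periodic (\<lambda>x. f x t)) \<and>
     lsc_on (UNIV \<times> {0..T}) (\<lambda>(x, t). f x t) \<and>
     (\<forall>\<psi> z s r. test_function T \<psi> \<and> 0 < s \<and> s < T \<and> 0 < r \<and> r < s \<and>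
        (\<forall>x. \<forall>t\<in>{s - r..s}. f x t - \<psi> x t \<ge> f z s - \<psi> z s) \<longrightarrow>
        deriv (\<psi> z) s \<ge> - \<kappa> * dirichlet_neumann (\<lambda>x. \<psi> x s) (\<lambda>x. \<psi> x s) z)"

text \<open>
  The tests above involve only times before \<open>T\<close>, and semicontinuity alone does not tie the
  values at time \<open>T\<close> to the earlier ones: a function that is 0 before time \<open>T\<close> and 1
  at time \<open>T\<close> is a bounded subsolution. The following conditions say that the value at
  \<open>(x, T)\<close> is a limit of values at earlier times; they hold for continuous functions.
\<close>

definition final_value_sub :: "real \<Rightarrow> (real \<Rightarrow> real \<Rightarrow> real) \<Rightarrow> real \<Rightarrow> bool" where
  "final_value_sub T f x \<longleftrightarrow>
     ereal (f x T) \<le> Limsup (at (x, T) within UNIV \<times> {0..<T}) (\<lambda>(y, t). ereal (f y t))"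

definition final_value_super :: "real \<Rightarrow> (real \<Rightarrow> real \<Rightarrow> real) \<Rightarrow> real \<Rightarrow> bool" where
  "final_value_super T f x \<longleftrightarrow>
     Liminf (at (x, T) within UNIV \<times> {0..<T}) (\<lambda>(y, t). ereal (f y t)) \<le> ereal (f x T)"

end

theory Submission
  imports Defs
begin

text \<open>
  The Dirichlet-Neumann operator enters only through its invariance: replacing a profile \<open>w\<close> by
  \<open>w (x + a) + c\<close> translates every admissible harmonic extension, so it translates the value of the
  operator, whether or not the limit in its definition exists. No elliptic theory is needed.

  If the comparison fails, then for large \<open>k\<close> and small \<open>\<mu>\<close> the function
  \<open>f x t - \<mu> / (T - t) - g y s - \<mu> / (T - s) - k (x - y)\<^sup>2 - k (t - s)\<^sup>2\<close> has a positive maximum,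
  attained at times in the open interval. Up to doubling \<open>k\<close> the coupling in time splits at the
  maximum; taking a supremum over \<open>t\<close> and an infimum over \<open>s\<close> leaves functions \<open>a\<close>, \<open>b\<close> of
  the space variable alone with \<open>a x - b y \<le> k (x - y)\<^sup>2\<close>. Ilmanen's interposition puts a
  \<open>C\<^sup>1\<^sup>,\<^sup>1\<close> function \<open>h\<close> between the sup-convolution of \<open>a\<close> and the inf-convolution of \<open>b\<close>. Translates
  of \<open>h\<close>, plus functions of time, touch \<open>f\<close> and \<open>g\<close> at the two points of the maximum. The two
  viscosity inequalities then contain the same Dirichlet-Neumann value and the same slope in
  time, and the penalties \<open>\<mu> / (T - t)\<close> make them contradictory.
\<close>


section \<open>Integrals of periodic functions over one period\<close>

text \<open>The linear functional \<open>l\<close> selects the periodic direction. With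
  \<open>fst\<close> this is one period of the cylinder, with the identity one period of the line,
  so integrals over the domain and over its boundary are handled by the same lemmas.\<close>

definition strip :: "('a \<Rightarrow> real) \<Rightarrow> 'a set" where
  "strip l = {p. 0 \<le> l p \<and> l p < 2 * pi}"

lemma lebesgue_distr_translation:
  fixes t :: "'a::euclidean_space"
  shows "distr lebesgue lebesgue (\<lambda>p. p + t) = lebesgue"
    and "(\<lambda>p. p + t) \<in> lebesgue \<rightarrow>\<^sub>M lebesgue"
proof -
  have eq: "(\<lambda>p. t + (\<Sum>j\<in>Basis. (1 * (p \<bullet> j)) *\<^sub>R j)) = (\<lambda>p. p + t)"
    by (auto simp: euclidean_representation add.commute)
  show "(\<lambda>p. p + t) \<in> lebesgue \<rightarrow>\<^sub>M lebesgue"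
    using lebesgue_affine_measurable[of "\<lambda>_. 1" t] unfolding eq by simp
  have "lebesgue = density (distr lebesgue lebesgue (\<lambda>p. p + t)) (\<lambda>_. 1)"
    using lebesgue_affine_euclidean[of "\<lambda>_. 1" t] unfolding eq by simp
  then show "distr lebesgue lebesgue (\<lambda>p. p + t) = lebesgue"
    by (simp add: density_1)
qed

lemma lebesgue_translation:
  fixes F :: "'a::euclidean_space \<Rightarrow> 'b::{banach, second_countable_topology}"
  shows measurable_lebesgue_translation:
      "F \<in> borel_measurable lebesgue \<Longrightarrow> (\<lambda>p. F (p + t)) \<in> borel_measurable lebesgue"
    and integrable_lebesgue_translation:
      "integrable lebesgue F \<Longrightarrow> integrable lebesgue (\<lambda>p. F (p + t))"
    and integral_lebesgue_translation:
      "integrable lebesgue F \<Longrightarrow> (\<integral>p. F (p + t) \<partial>lebesgue) = (\<integral>p. F p \<partial>lebesgue)"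
proof -
  note T = lebesgue_distr_translation[of t]
  show 1: "(\<lambda>p. F (p + t)) \<in> borel_measurable lebesgue" if "F \<in> borel_measurable lebesgue"
    using measurable_compose[OF T(2) that] .
  show "integrable lebesgue (\<lambda>p. F (p + t))" if "integrable lebesgue F"
    using integrable_distr[OF T(2), of F] that unfolding T(1) by simp
  show "(\<integral>p. F (p + t) \<partial>lebesgue) = (\<integral>p. F p \<partial>lebesgue)" if "integrable lebesgue F"
    using integral_distr[OF T(2), of F] borel_measurable_integrable[OF that] unfolding T(1) by simp
qed

text \<open>Cut the strip at level \<open>l v\<close>. The upper part is moved by \<open>v\<close>,
  the lower part by \<open>v - e\<close>, and the two translates tile the strip again; by
  periodicity the integrand does not notice the difference of \<open>e\<close>.\<close>

lemma strip_translate_aux: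
  fixes F :: "'a::euclidean_space \<Rightarrow> 'b::{banach, second_countable_topology}"
  assumes l: "linear l" and e: "l e = 2 * pi" and v: "0 \<le> l v" "l v \<le> 2 * pi"
    and per: "\<And>p. F (p + e) = F p"
  shows "(\<lambda>p. indicator (strip l) p *\<^sub>R F p) \<in> borel_measurable lebesgue \<Longrightarrow>
         (\<lambda>p. indicator (strip l) p *\<^sub>R F (p + v)) \<in> borel_measurable lebesgue"
    and "integrable lebesgue (\<lambda>p. indicator (strip l) p *\<^sub>R F p) \<Longrightarrow>
         integrable lebesgue (\<lambda>p. indicator (strip l) p *\<^sub>R F (p + v)) \<and>
         (\<integral>p. indicator (strip l) p *\<^sub>R F (p + v) \<partial>lebesgue) =
         (\<integral>p. indicator (strip l) p *\<^sub>R F p \<partial>lebesgue)"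
proof -
  define H where "H = (\<lambda>p. indicator (strip l) p *\<^sub>R F p)"
  define P where "P = {p. l v \<le> l p}"
  define H1 where "H1 p = indicator P p *\<^sub>R H p" for p
  define H2 where "H2 p = indicator (- P) p *\<^sub>R H p" for p
  interpret l: linear l by (rule l)
  have "continuous_on UNIV l"
    using l by (simp add: linear_continuous_on linear_conv_bounded_linear)
  then have "closed P" unfolding P_def
    by (intro closed_Collect_le continuous_on_const)
  then have P: "P \<in> sets lebesgue" "- P \<in> sets lebesgue"
    by (auto intro: lebesgue_closedin borel_closed)
  have per': "F (p + (v - e)) = F (p + v)" for p
    using per[of "p + (v - e)"] by (simp add: algebra_simps)
  have split: "indicator (strip l) p *\<^sub>R F (p + v) = H1 (p + v) + H2 (p + (v - e))" for p
    using v unfolding H1_def H2_def H_def P_def strip_def per'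
    by (auto simp: indicator_def l.add l.diff e)
  have H: "H p = H1 p + H2 p" for p
    by (auto simp: H1_def H2_def indicator_def)
  show "(\<lambda>p. indicator (strip l) p *\<^sub>R F (p + v)) \<in> borel_measurable lebesgue"
    if "(\<lambda>p. indicator (strip l) p *\<^sub>R F p) \<in> borel_measurable lebesgue"
  proof -
    have "H1 \<in> borel_measurable lebesgue" "H2 \<in> borel_measurable lebesgue"
      unfolding H1_def H2_def using that P unfolding H_def[symmetric]
      by (auto intro!: borel_measurable_scaleR borel_measurable_indicator)
    then show ?thesis unfolding split
      by (intro borel_measurable_add measurable_lebesgue_translation)
  qed
  show "integrable lebesgue (\<lambda>p. indicator (strip l) p *\<^sub>R F (p + v)) \<and>
         (\<integral>p. indicator (strip l) p *\<^sub>R F (p + v) \<partial>lebesgue) =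
         (\<integral>p. indicator (strip l) p *\<^sub>R F p \<partial>lebesgue)"
    if "integrable lebesgue (\<lambda>p. indicator (strip l) p *\<^sub>R F p)"
  proof -
    have I: "integrable lebesgue H1" "integrable lebesgue H2"
      unfolding H1_def H2_def using that P unfolding H_def[symmetric]
      by (auto intro!: integrable_mult_indicator)
    have "(\<integral>p. indicator (strip l) p *\<^sub>R F (p + v) \<partial>lebesgue) =
        (\<integral>p. H1 (p + v) \<partial>lebesgue) + (\<integral>p. H2 (p + (v - e)) \<partial>lebesgue)"
      unfolding split
      by (intro Bochner_Integration.integral_add integrable_lebesgue_translation I)
    also have "\<dots> = (\<integral>p. H1 p \<partial>lebesgue) + (\<integral>p. H2 p \<partial>lebesgue)"
      by (simp only: integral_lebesgue_translation I)
    also have "\<dots> = (\<integral>p. H p \<partial>lebesgue)"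
      unfolding H by (intro Bochner_Integration.integral_add[symmetric] I)
    finally show ?thesis
      unfolding split H_def using I
      by (simp add: integrable_lebesgue_translation split)
  qed
qed

lemma strip_translate:
  fixes F :: "'a::euclidean_space \<Rightarrow> 'b::{banach, second_countable_topology}"
  assumes l: "linear l" and e: "l e = 2 * pi" and v: "0 \<le> l v" "l v \<le> 2 * pi"
    and per: "\<And>p. F (p + e) = F p"
  shows measurable_strip_translate:
      "(\<lambda>p. indicator (strip l) p *\<^sub>R F p) \<in> borel_measurable lebesgue \<Longrightarrow>
       (\<lambda>p. indicator (strip l) p *\<^sub>R F (p + v)) \<in> borel_measurable lebesgue"
    and integrable_strip_translate:
      "integrable lebesgue (\<lambda>p. indicator (strip l) p *\<^sub>R F p) \<Longrightarrow>
       integrable lebesgue (\<lambda>p. indicator (strip l) p *\<^sub>R F (p + v))"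
    and integral_strip_translate:
      "(\<integral>p. indicator (strip l) p *\<^sub>R F (p + v) \<partial>lebesgue) =
       (\<integral>p. indicator (strip l) p *\<^sub>R F p \<partial>lebesgue)"
proof -
  note aux = strip_translate_aux[of l e v F, OF l e v per]
  interpret l: linear l by (rule l)
  show "(\<lambda>p. indicator (strip l) p *\<^sub>R F p) \<in> borel_measurable lebesgue \<Longrightarrow>
       (\<lambda>p. indicator (strip l) p *\<^sub>R F (p + v)) \<in> borel_measurable lebesgue"
    by (rule aux(1))
  show "integrable lebesgue (\<lambda>p. indicator (strip l) p *\<^sub>R F p) \<Longrightarrow>
       integrable lebesgue (\<lambda>p. indicator (strip l) p *\<^sub>R F (p + v))"
    using aux(2) by blast
  \<comment> \<open>A further translation by \<open>e - v\<close> completes a full period, so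
    integrability passes in both directions. If it fails, both Bochner integrals have the default
    value 0, and the equality holds without an integrability hypothesis.\<close>
  have conv: "integrable lebesgue (\<lambda>p. indicator (strip l) p *\<^sub>R F (p + v)) \<Longrightarrow>
      integrable lebesgue (\<lambda>p. indicator (strip l) p *\<^sub>R F p)"
    using strip_translate_aux(2)[of l e "e - v" "\<lambda>p. F (p + v)"] l e v per
      per[of "p + v" for p] by (simp add: l.diff add.assoc add.commute[of _ e] add.left_commute)
  show "(\<integral>p. indicator (strip l) p *\<^sub>R F (p + v) \<partial>lebesgue) =
       (\<integral>p. indicator (strip l) p *\<^sub>R F p \<partial>lebesgue)"
    using aux(2) conv not_integrable_integral_eq by metis
qed


section \<open>Translations of harmonic extensions\<close>

text \<open>Extending \<open>u\<close> by zero outside the periodic set \<open>S\<close> gives a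
  periodic function on the whole space, to which the translation of a strip applies.\<close>

lemma set_strip_translate:
  fixes u :: "'a::euclidean_space \<Rightarrow> 'b::{banach, second_countable_topology}"
  assumes l: "linear l" and e: "l e = 2 * pi" and v: "0 \<le> l v" "l v \<le> 2 * pi"
    and S: "\<And>p. p + e \<in> S \<longleftrightarrow> p \<in> S" and u: "\<And>p. u (p + e) = u p"
  shows set_borel_measurable_strip_translate:
      "set_borel_measurable lebesgue (strip l \<inter> S) u \<Longrightarrow>
       set_borel_measurable lebesgue (strip l \<inter> {p. p + v \<in> S}) (\<lambda>p. u (p + v))"
    and set_integrable_strip_translate:
      "set_integrable lebesgue (strip l \<inter> S) u \<Longrightarrow>
       set_integrable lebesgue (strip l \<inter> {p. p + v \<in> S}) (\<lambda>p. u (p + v))"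
    and set_integral_strip_translate:
      "(LINT p:strip l \<inter> {p. p + v \<in> S}|lebesgue. u (p + v)) = (LINT p:strip l \<inter> S|lebesgue. u p)"
proof -
  define F where "F p = indicator S p *\<^sub>R u p" for p
  have per: "F (p + e) = F p" for p
    using S u by (simp add: F_def indicator_def)
  have 1: "indicator (strip l \<inter> S) p *\<^sub>R u p = indicator (strip l) p *\<^sub>R F p" for p
    by (simp add: F_def indicator_def)
  have 2: "indicator (strip l \<inter> {p. p + v \<in> S}) p *\<^sub>R u (p + v) =
      indicator (strip l) p *\<^sub>R F (p + v)" for p
    by (simp add: F_def indicator_def)
  note * = strip_translate[of l e v F, OF l e v per]
  show "set_borel_measurable lebesgue (strip l \<inter> S) u \<Longrightarrow>
       set_borel_measurable lebesgue (strip l \<inter> {p. p + v \<in> S}) (\<lambda>p. u (p + v))"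
    unfolding set_borel_measurable_def 1 2 by (rule *(1))
  show "set_integrable lebesgue (strip l \<inter> S) u \<Longrightarrow>
       set_integrable lebesgue (strip l \<inter> {p. p + v \<in> S}) (\<lambda>p. u (p + v))"
    unfolding set_integrable_def 1 2 by (rule *(2))
  show "(LINT p:strip l \<inter> {p. p + v \<in> S}|lebesgue. u (p + v)) = (LINT p:strip l \<inter> S|lebesgue. u p)"
    unfolding set_lebesgue_integral_def 1 2 by (rule *(3))
qed

lemma L2_on_strip_translate:
  fixes u :: "'a::euclidean_space \<Rightarrow> 'b::euclidean_space"
  assumes "linear l" "l e = 2 * pi" "0 \<le> l v" "l v \<le> 2 * pi"
    and "\<And>p. p + e \<in> S \<longleftrightarrow> p \<in> S" "\<And>p. u (p + e) = u p" and "L2_on (strip l \<inter> S) u"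
  shows "L2_on (strip l \<inter> {p. p + v \<in> S}) (\<lambda>p. u (p + v))"
  using assms set_borel_measurable_strip_translate[of l e v S u]
    set_integrable_strip_translate[of l e v S "\<lambda>p. (norm (u p))\<^sup>2"]
  unfolding L2_on_def by simp

lemma L2_tendsto_strip_translate:
  fixes u :: "'a::euclidean_space \<Rightarrow> 'b::euclidean_space"
  assumes "linear l" "l e = 2 * pi" "0 \<le> l v" "l v \<le> 2 * pi"
    and "\<And>p. p + e \<in> S \<longleftrightarrow> p \<in> S" "\<And>p. u (p + e) = u p" "\<And>n p. w n (p + e) = w n p"
    and "L2_tendsto (strip l \<inter> S) w u"
  shows "L2_tendsto (strip l \<inter> {p. p + v \<in> S}) (\<lambda>n p. w n (p + v)) (\<lambda>p. u (p + v))"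
proof -
  have "L2_on (strip l \<inter> {p. p + v \<in> S}) (\<lambda>p. u (p + v))"
    "L2_on (strip l \<inter> {p. p + v \<in> S}) (\<lambda>p. w n (p + v))" for n
    using assms by (auto simp: L2_tendsto_def intro!: L2_on_strip_translate[of l e v S])
  moreover have "(LINT p:strip l \<inter> {p. p + v \<in> S}|lebesgue. (norm (w n (p + v) - u (p + v)))\<^sup>2) =
      (LINT p:strip l \<inter> S|lebesgue. (norm (w n p - u p))\<^sup>2)" for n
    using assms by (intro set_integral_strip_translate[of l e v S "\<lambda>p. (norm (w n p - u p))\<^sup>2"]) auto
  ultimately show ?thesis
    using assms(8) unfolding L2_tendsto_def by simp
qed

section \<open>Translations of periodic functions, gradients and test functions\<close>

lemma periodic_fst_iff: "periodic_fst u \<longleftrightarrow> (\<forall>p. u (p + (2 * pi, 0)) = u p)"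
  unfolding periodic_fst_def by auto

lemma periodic_fst_translate: "periodic_fst u \<Longrightarrow> periodic_fst (\<lambda>p. u (p + v))"
proof -
  assume "periodic_fst u"
  then have "u (p + v + (2 * pi, 0)) = u (p + v)" for p unfolding periodic_fst_iff by blast
  moreover have "p + (2 * pi, 0) + v = p + v + (2 * pi, 0)" for p :: "real \<times> real"
    by (simp only: ac_simps)
  ultimately show ?thesis unfolding periodic_fst_iff by metis
qed

lemma periodic_int:
  assumes "periodic u" shows "u (x + 2 * pi * of_int k) = u x"
proof -
  interpret periodic_fun_simple u "2 * pi"
    using assms by unfold_locales (auto simp: periodic_def)
  show ?thesis using plus_of_int[of x k] by (simp add: mult.commute)
qed

lemma periodic_translate: "periodic u \<Longrightarrow> periodic (\<lambda>x. u (x + a))"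
proof -
  assume "periodic u"
  then have "u (x + a + 2 * pi) = u (x + a)" for x unfolding periodic_def by blast
  moreover have "x + 2 * pi + a = x + a + 2 * pi" for x by simp
  ultimately show ?thesis unfolding periodic_def by metis
qed

text \<open>The number \<open>b\<close> differs from \<open>a\<close> by a multiple of the period,
  so it serves all periodic functions and all points at once; several functions can be moved into
  one period by a common shift.\<close>

lemma periodic_reduce:
  obtains b :: real where "0 \<le> b" "b \<le> 2 * pi" "\<And>(u :: real \<Rightarrow> 'a) x. periodic u \<Longrightarrow> u (x + a) = u (x + b)"
proof
  define k where "k = \<lfloor>a / (2 * pi)\<rfloor>"
  define b where "b = a - 2 * pi * of_int k"
  have "of_int k \<le> a / (2 * pi)" "a / (2 * pi) < of_int k + 1"
    unfolding k_def by linarith+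
  then show "0 \<le> b" "b \<le> 2 * pi"
    unfolding b_def by (simp_all add: field_simps)
  show "u (x + a) = u (x + b)" if "periodic u" for u :: "real \<Rightarrow> 'a" and x
    using periodic_int[OF that, of "x + b" k] by (simp add: b_def algebra_simps)
qed

lemma gderiv_translate:
  fixes \<eta> :: "'a::real_inner \<Rightarrow> real"
  assumes "GDERIV \<eta> (p + v) :> D" shows "GDERIV (\<lambda>p. \<eta> (p + v)) p :> D"
proof -
  have "((\<lambda>p. p + v) has_derivative (\<lambda>h. h)) (at p)"
    by (intro has_derivative_eq_rhs[OF has_derivative_add[OF has_derivative_ident has_derivative_const]]) simp
  then show ?thesis
    using assms unfolding gderiv_def by (rule has_derivative_compose)
qed

lemma gderiv_unique:
  assumes "GDERIV \<eta> p :> D" "GDERIV \<eta> p :> E" shows "D = E"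
proof -
  have "(\<lambda>h. h \<bullet> D) = (\<lambda>h. h \<bullet> E)"
    using assms has_derivative_unique unfolding gderiv_def by blast
  from fun_cong[OF this, of "D - E"] have "(D - E) \<bullet> (D - E) = 0"
    by (simp add: inner_diff_right)
  then show ?thesis by simp
qed

lemma C1_grad_translate:
  assumes "C1_grad \<eta> D" shows "C1_grad (\<lambda>p. \<eta> (p + v)) (\<lambda>p. D (p + v))"
proof -
  have "periodic_fst (\<lambda>p. \<eta> (p + v))"
    by (rule periodic_fst_translate) (use assms in \<open>simp add: C1_grad_def\<close>)
  moreover have "continuous_on UNIV (\<lambda>p. D (p + v))"
    by (rule continuous_on_compose2[of UNIV D])
      (use assms in \<open>auto simp: C1_grad_def intro!: continuous_intros\<close>)
  moreover have "GDERIV (\<lambda>p. \<eta> (p + v)) p :> D (p + v)" for p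
    by (rule gderiv_translate) (use assms in \<open>unfold C1_grad_def, blast\<close>)
  ultimately show ?thesis
    unfolding C1_grad_def by blast
qed

text \<open>The definition of \<open>C1_grad\<close> states periodicity of the function; that of
  \<open>D\<close> follows because gradients are unique.\<close>

lemma C1_grad_periodic:
  assumes "C1_grad \<eta> D" shows "\<eta> (p + (2 * pi, 0)) = \<eta> p" "D (p + (2 * pi, 0)) = D p"
proof -
  show *: "\<eta> (p + (2 * pi, 0)) = \<eta> p" for p
    using assms unfolding C1_grad_def periodic_fst_iff by blast
  have "GDERIV (\<lambda>p. \<eta> (p + (2 * pi, 0))) p :> D (p + (2 * pi, 0))"
    by (rule gderiv_translate) (use assms in \<open>unfold C1_grad_def, blast\<close>)
  then show "D (p + (2 * pi, 0)) = D p"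
    unfolding * using assms gderiv_unique unfolding C1_grad_def by blast
qed

text \<open>The support condition looks at a single closed period, while a translated period
  straddles two. The new compact set is therefore the union of the translates of \<open>K\<close> by
  \<open>?v\<close> and by \<open>?v - ?e\<close>; which one contains a given point depends on
  whether its abscissa is at least \<open>a\<close>.\<close>

lemma C1_test_translate:
  assumes f: "periodic f" and a: "0 \<le> a" "a \<le> 2 * pi"
    and test: "C1_test (\<lambda>x. f (x + a) + c) \<eta> D"
  shows "C1_test f (\<lambda>p. \<eta> (p - (a, -c))) (\<lambda>p. D (p - (a, -c)))"
proof -
  let ?v = "(a, -c)" and ?e = "(2 * pi, 0::real)"
  from test obtain K where K: "compact K" "K \<subseteq> subgraph (\<lambda>x. f (x + a) + c)"
    and supp: "\<And>x y. 0 \<le> x \<Longrightarrow> x \<le> 2 * pi \<Longrightarrow> \<eta> (x, y) \<noteq> 0 \<Longrightarrow> (x, y) \<in> K"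
    and C1: "C1_grad \<eta> D"
    unfolding C1_test_def by blast
  define L where "L = (\<lambda>p. p + ?v) ` K \<union> (\<lambda>p. p + (?v - ?e)) ` K"
  have per: "f (x - 2 * pi) = f x" for x
    using periodic_int[OF f, of x "-1"] by simp
  have "compact L"
    unfolding L_def by (intro compact_Un compact_continuous_image K(1) continuous_intros)
  moreover have "L \<subseteq> subgraph f"
  proof -
    have "f (x + (a - 2 * pi)) = f (x + a)" for x
      using per[of "x + a"] by (simp only: add_diff_eq)
    then show ?thesis
      using K(2) by (fastforce simp: L_def subgraph_def)
  qed
  moreover have "(x, y) \<in> L" if x: "0 \<le> x" "x \<le> 2 * pi" and nz: "\<eta> ((x, y) - ?v) \<noteq> 0" for x y
  proof (cases "a \<le> x")
    case True
    then have "(x, y) - ?v \<in> K" using supp[of "x - a" "y + c"] x a nz by simp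
    then have "((x, y) - ?v) + ?v \<in> L" unfolding L_def by blast
    then show ?thesis by simp
  next
    case False
    have "\<eta> (((x, y) - ?v) + ?e) \<noteq> 0" using nz C1_grad_periodic(1)[OF C1] by metis
    then have "((x, y) - ?v) + ?e \<in> K"
      using supp[of "x - a + 2 * pi" "y + c"] x a False by simp
    then have "(((x, y) - ?v) + ?e) + (?v - ?e) \<in> L" unfolding L_def by blast
    then show ?thesis by simp
  qed
  moreover have "C1_grad (\<lambda>p. \<eta> (p - ?v)) (\<lambda>p. D (p - ?v))"
    using C1_grad_translate[OF C1, of "- ?v"] unfolding diff_conv_add_uminus .
  ultimately show ?thesis
    unfolding C1_test_def by blast
qed

section \<open>Translation of the domain together with the harmonic extension\<close>

lemma subgraph_cell_eq: "subgraph_cell f = strip fst \<inter> subgraph f"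
  by (auto simp: subgraph_cell_def strip_def subgraph_def)

lemma subgraph_translate:
  "subgraph (\<lambda>x. f (x + a) + c) = {p. p + (a, -c) \<in> subgraph f}"
  by (auto simp: subgraph_def)

text \<open>Raising the domain by \<open>c\<close> leaves the boundary data at their old height; a
  constant is added to the data separately. Each integral condition becomes the original one, tested
  with the back-translated function, by a change of variables over one period.\<close>

lemma harmonic_extension_translate_aux:
  assumes f: "periodic f" and g: "periodic g" and a: "0 \<le> a" "a \<le> 2 * pi"
    and H: "harmonic_extension f g \<phi>"
  shows "harmonic_extension (\<lambda>x. f (x + a) + c) (\<lambda>x. g (x + a)) (\<lambda>p. \<phi> (p + (a, -c)))"
proof -
  let ?v = "(a, -c)" and ?e = "(2 * pi, 0::real)" and ?f = "\<lambda>x. f (x + a) + c"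
  obtain V where V: "weak_gradient f \<phi> V" "L2_on (subgraph_cell f) V" "has_trace f \<phi> V g"
    and harm: "\<And>\<eta> D. C1_test f \<eta> D \<Longrightarrow> (LINT p:subgraph_cell f|lebesgue. V p \<bullet> D p) = 0"
    and \<phi>: "periodic_fst \<phi>" "continuous_on (subgraph f) \<phi>" "\<And>x. \<phi> (x, f x) = g x"
    using H unfolding harmonic_extension_def by blast
  have Vper: "V (p + ?e) = V p" for p
    using V(1) unfolding weak_gradient_def periodic_fst_iff by blast
  have \<phi>per: "\<phi> (p + ?e) = \<phi> p" for p
    using \<phi>(1) unfolding periodic_fst_iff by blast
  have S: "p + ?e \<in> subgraph f \<longleftrightarrow> p \<in> subgraph f" for p
    using f by (cases p) (simp add: subgraph_def periodic_def)
  have v: "fst ?e = 2 * pi" "0 \<le> fst ?v" "fst ?v \<le> 2 * pi" using a by auto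
  have cell: "subgraph_cell ?f = strip fst \<inter> {p. p + ?v \<in> subgraph f}"
    unfolding subgraph_cell_eq subgraph_translate ..
  \<comment> \<open>Change of variables between one period of the shifted domain and one period of
    the original one; \<open>w\<close> is the integrand in the original coordinates.\<close>
  have int: "(LINT p:subgraph_cell ?f|lebesgue. u p) = (LINT p:subgraph_cell f|lebesgue. w p)"
    if "\<And>p. w (p + ?e) = w p" "\<And>p. u p = w (p + ?v)"
    for u w :: "real \<times> real \<Rightarrow> 'c::{banach, second_countable_topology}"
    unfolding that(2) cell subgraph_cell_eq
    by (rule set_integral_strip_translate[of fst ?e ?v "subgraph f" w, OF linear_fst v S that(1)])
  have test: "C1_test f (\<lambda>p. \<eta> (p - ?v)) (\<lambda>p. D (p - ?v))"
    and test_per: "\<eta> (p + ?e - ?v) = \<eta> (p - ?v)" "D (p + ?e - ?v) = D (p - ?v)"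
    if "C1_test ?f \<eta> D" for \<eta> D p
  proof -
    show *: "C1_test f (\<lambda>p. \<eta> (p - ?v)) (\<lambda>p. D (p - ?v))"
      by (rule C1_test_translate[OF f a that])
    then have "C1_grad (\<lambda>p. \<eta> (p - ?v)) (\<lambda>p. D (p - ?v))" unfolding C1_test_def by blast
    from C1_grad_periodic[OF this] show "\<eta> (p + ?e - ?v) = \<eta> (p - ?v)" "D (p + ?e - ?v) = D (p - ?v)"
      by auto
  qed
  have pV: "periodic_fst (\<lambda>p. V (p + ?v))"
    by (rule periodic_fst_translate) (use V(1) in \<open>simp add: weak_gradient_def\<close>)
  have "weak_gradient ?f (\<lambda>p. \<phi> (p + ?v)) (\<lambda>p. V (p + ?v))"
    unfolding weak_gradient_def
  proof (intro conjI allI impI pV)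
    fix \<eta> D assume t: "C1_test ?f \<eta> D"
    have "(LINT p:subgraph_cell ?f|lebesgue. \<phi> (p + ?v) *\<^sub>R D p) =
        (LINT p:subgraph_cell f|lebesgue. \<phi> p *\<^sub>R D (p - ?v))"
      by (rule int) (simp_all only: \<phi>per test_per[OF t] add_diff_cancel)
    also have "\<dots> = - (LINT p:subgraph_cell f|lebesgue. \<eta> (p - ?v) *\<^sub>R V p)"
      using V(1) test[OF t] unfolding weak_gradient_def by blast
    also have "(LINT p:subgraph_cell f|lebesgue. \<eta> (p - ?v) *\<^sub>R V p) =
        (LINT p:subgraph_cell ?f|lebesgue. \<eta> p *\<^sub>R V (p + ?v))"
      by (rule int[symmetric]) (simp_all only: Vper test_per[OF t] add_diff_cancel)
    finally show "(LINT p:subgraph_cell ?f|lebesgue. \<phi> (p + ?v) *\<^sub>R D p) =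
        - (LINT p:subgraph_cell ?f|lebesgue. \<eta> p *\<^sub>R V (p + ?v))" .
  qed
  moreover have "L2_on (subgraph_cell ?f) (\<lambda>p. V (p + ?v))"
    using V(2) unfolding cell subgraph_cell_eq
    by (rule L2_on_strip_translate[of fst ?e ?v "subgraph f" V, OF linear_fst v S Vper])
  moreover have "has_trace ?f (\<lambda>p. \<phi> (p + ?v)) (\<lambda>p. V (p + ?v)) (\<lambda>x. g (x + a))"
  proof -
    obtain w D where C1: "\<And>n. C1_grad (w n) (D n)"
      and w: "\<And>m. L2_tendsto (subgraph_cell f \<inter> {p. m < snd p}) w \<phi>"
      and D: "\<And>m. L2_tendsto (subgraph_cell f \<inter> {p. m < snd p}) D V"
      and tr: "L2_tendsto {0..<2 * pi} (\<lambda>n x. w n (x, f x)) g"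
      using V(3) unfolding has_trace_def by blast
    \<comment> \<open>Truncation at height \<open>m\<close> in the raised domain corresponds to
      height \<open>m - c\<close> in the original one, which is harmless because the trace condition
      covers every height.\<close>
    have cell': "subgraph_cell ?f \<inter> {p. m < snd p} =
        strip fst \<inter> {p. p + ?v \<in> subgraph f \<inter> {p. m - c < snd p}}" for m
      unfolding cell by auto
    have S': "p + ?e \<in> subgraph f \<inter> {p. m < snd p} \<longleftrightarrow> p \<in> subgraph f \<inter> {p. m < snd p}" for p m
      using S by auto
    have "L2_tendsto (subgraph_cell ?f \<inter> {p. m < snd p}) (\<lambda>n p. w n (p + ?v)) (\<lambda>p. \<phi> (p + ?v))" for m
      unfolding cell' by (rule L2_tendsto_strip_translate[of fst ?e ?v "subgraph f \<inter> {p. m - c < snd p}" \<phi> w, OF linear_fst v S' \<phi>per])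
        (use w[of "m - c"] C1_grad_periodic[OF C1] in \<open>simp_all add: subgraph_cell_eq Int_assoc\<close>)
    moreover have "L2_tendsto (subgraph_cell ?f \<inter> {p. m < snd p}) (\<lambda>n p. D n (p + ?v)) (\<lambda>p. V (p + ?v))" for m
      unfolding cell' by (rule L2_tendsto_strip_translate[of fst ?e ?v "subgraph f \<inter> {p. m - c < snd p}" V D, OF linear_fst v S' Vper])
        (use D[of "m - c"] C1_grad_periodic[OF C1] in \<open>simp_all add: subgraph_cell_eq Int_assoc\<close>)
    moreover have "L2_tendsto {0..<2 * pi} (\<lambda>n x. w n ((x, ?f x) + ?v)) (\<lambda>x. g (x + a))"
    proof -
      \<comment> \<open>The boundary values are parametrised by the line, so here the strip is taken
        for the identity functional.\<close>
      have s: "strip (\<lambda>x :: real. x) \<inter> S = {0..<2 * pi} \<inter> S" for S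
        by (auto simp: strip_def)
      have "w n (x + 2 * pi, f (x + 2 * pi)) = w n (x, f x)" for n x
        using C1_grad_periodic(1)[OF C1, of n "(x, f x)"] f by (simp add: periodic_def)
      moreover have "g (x + 2 * pi) = g x" for x using g by (simp add: periodic_def)
      ultimately have "L2_tendsto (strip (\<lambda>x. x) \<inter> {x. x + a \<in> UNIV})
          (\<lambda>n x. w n (x + a, f (x + a))) (\<lambda>x. g (x + a))"
        using L2_tendsto_strip_translate[of "\<lambda>x. x" "2 * pi" a UNIV g "\<lambda>n x. w n (x, f x)"]
          linear_ident tr a unfolding s by simp
      then show ?thesis unfolding s by simp
    qed
    ultimately show ?thesis
      unfolding has_trace_def using C1_grad_translate[OF C1, of _ ?v]
      by (intro exI[of _ "\<lambda>n p. w n (p + ?v)"] exI[of _ "\<lambda>n p. D n (p + ?v)"]) simp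
  qed
  moreover have "(LINT p:subgraph_cell ?f|lebesgue. V (p + ?v) \<bullet> D p) = 0" if t: "C1_test ?f \<eta> D" for \<eta> D
  proof -
    have "(LINT p:subgraph_cell ?f|lebesgue. V (p + ?v) \<bullet> D p) =
        (LINT p:subgraph_cell f|lebesgue. V p \<bullet> D (p - ?v))"
      by (rule int) (simp_all only: Vper test_per[OF t] add_diff_cancel)
    then show ?thesis using harm[OF test[OF t]] by simp
  qed
  moreover have "periodic_fst (\<lambda>p. \<phi> (p + ?v))"
    by (rule periodic_fst_translate[OF \<phi>(1)])
  moreover have "continuous_on (subgraph ?f) (\<lambda>p. \<phi> (p + ?v))"
    by (rule continuous_on_compose2[OF \<phi>(2)]) (auto intro!: continuous_intros simp: subgraph_def)
  moreover have "\<phi> ((x, ?f x) + ?v) = g (x + a)" for x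
    using \<phi>(3)[of "x + a"] by simp
  ultimately show ?thesis
    unfolding harmonic_extension_def by blast
qed

text \<open>An arbitrary shift reduces to one within a period, since \<open>f\<close> and
  \<open>g\<close> are periodic and \<phi> is periodic at every height.\<close>

lemma harmonic_extension_translate:
  assumes f: "periodic f" and g: "periodic g" and H: "harmonic_extension f g \<phi>"
  shows "harmonic_extension (\<lambda>x. f (x + a) + c) (\<lambda>x. g (x + a)) (\<lambda>p. \<phi> (p + (a, -c)))"
proof -
  obtain b where b: "0 \<le> b" "b \<le> 2 * pi"
    and eq: "\<And>(u :: real \<Rightarrow> real) x. periodic u \<Longrightarrow> u (x + a) = u (x + b)"
    using periodic_reduce[of a] by blast
  have "\<phi> (p + (a, -c)) = \<phi> (p + (b, -c))" for p
    using H eq[of "\<lambda>x. \<phi> (x, snd p - c)" "fst p"]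
    by (cases p) (simp add: harmonic_extension_def periodic_def periodic_fst_def)
  then show ?thesis
    using harmonic_extension_translate_aux[OF f g b H, of c] eq[OF f] eq[OF g] by simp
qed


section \<open>Additive constants and the Dirichlet-Neumann operator\<close>

lemma C11_continuous: "C11 f \<Longrightarrow> continuous_on S f"
  by (auto simp: C11_def intro!: differentiable_imp_continuous_on differentiable_at_imp_differentiable_on)

lemma subgraph_open: assumes "continuous_on UNIV f" shows "open (subgraph f)"
proof -
  have "subgraph f = {p. snd p < f (fst p)}" by (auto simp: subgraph_def)
  moreover have "open {p. snd p < f (fst p)}"
    by (intro open_Collect_less continuous_intros continuous_on_compose2[OF assms]) auto
  ultimately show ?thesis by simp
qed

lemma strip_fst_sets: "strip (fst :: real \<times> real \<Rightarrow> real) \<in> sets lebesgue"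
proof -
  have "strip (fst :: real \<times> real \<Rightarrow> real) = {p. 0 \<le> fst p} \<inter> {p. fst p < 2 * pi}"
    by (auto simp: strip_def)
  moreover have "{p :: real \<times> real. 0 \<le> fst p} \<in> sets lebesgue"
    by (rule sets_completionI_sets) (simp add: borel_closed closed_Collect_le continuous_on_fst continuous_on_id continuous_on_const)
  moreover have "{p :: real \<times> real. fst p < 2 * pi} \<in> sets lebesgue"
    by (rule sets_completionI_sets) (simp add: borel_open open_Collect_less continuous_on_fst continuous_on_id continuous_on_const)
  ultimately show ?thesis by simp
qed

text \<open>Finite measure makes constants square integrable on truncated cells, as is needed to add
  a constant in the trace condition. The truncated cell lies in a box because a continuous function
  is bounded on one period.\<close>

lemma subgraph_cell_truncated:
  assumes f: "continuous_on UNIV f"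
  shows "subgraph_cell f \<inter> {p. m < snd p} \<in> lmeasurable"
proof (rule bounded_set_imp_lmeasurable)
  have "open {p :: real \<times> real. m < snd p}"
    by (intro open_Collect_less continuous_intros)
  then have "subgraph f \<inter> {p. m < snd p} \<in> sets lebesgue"
    using subgraph_open[OF f] by (intro sets_completionI_sets) (simp add: open_Int borel_open)
  then show "subgraph_cell f \<inter> {p. m < snd p} \<in> sets lebesgue"
    unfolding subgraph_cell_eq Int_assoc by (intro sets.Int[OF strip_fst_sets])
  have "compact (f ` {0..2 * pi})"
    by (intro compact_continuous_image continuous_on_subset[OF f]) auto
  then have "bdd_above (f ` {0..2 * pi})"
    by (intro bounded_imp_bdd_above compact_imp_bounded)
  then obtain B where B: "\<And>x. 0 \<le> x \<Longrightarrow> x \<le> 2 * pi \<Longrightarrow> f x \<le> B"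
    unfolding bdd_above_def ball_simps by (metis atLeastAtMost_iff)
  have "subgraph_cell f \<inter> {p. m < snd p} \<subseteq> cbox (0, m) (2 * pi, B)"
    using B by (auto simp: subgraph_cell_def cbox_Pair_eq) (meson less_imp_le order_trans)
  then show "bounded (subgraph_cell f \<inter> {p. m < snd p})"
    using bounded_cbox bounded_subset by blast
qed

text \<open>The square of \<open>u p + c\<close> is dominated by
  \<open>2 * (u p)\<^sup>2 + 2 * c\<^sup>2\<close>, which is integrable over a set of finite
  measure.\<close>

lemma L2_on_add_const:
  fixes u :: "'a::euclidean_space \<Rightarrow> real"
  assumes A: "A \<in> lmeasurable" and u: "L2_on A u" shows "L2_on A (\<lambda>p. u p + c)"
proof -
  have const: "set_integrable lebesgue A (\<lambda>_. k :: real)" for k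
    using A by (auto simp: set_integrable_def fmeasurable_def)
  have m: "set_borel_measurable lebesgue A (\<lambda>p. u p + c)"
    unfolding set_borel_measurable_def scaleR_add_right
  proof (rule borel_measurable_add)
    show "(\<lambda>p. indicator A p *\<^sub>R u p) \<in> borel_measurable lebesgue"
      using u by (simp add: L2_on_def set_borel_measurable_def)
    show "(\<lambda>p. indicator A p *\<^sub>R c) \<in> borel_measurable lebesgue"
      using const[of c] unfolding set_integrable_def by (rule borel_measurable_integrable)
  qed
  have "set_integrable lebesgue A (\<lambda>p. 2 * (u p)\<^sup>2 + 2 * c\<^sup>2)"
    using u const by (intro set_integral_add set_integrable_mult_right) (auto simp: L2_on_def)
  then have "set_integrable lebesgue A (\<lambda>p. (u p + c)\<^sup>2)"
  proof (rule set_integrable_bound)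
    have "(\<lambda>p. (indicator A p *\<^sub>R (u p + c))\<^sup>2) \<in> borel_measurable lebesgue"
      using m unfolding set_borel_measurable_def by (rule borel_measurable_power)
    moreover have "(indicator A p *\<^sub>R (u p + c))\<^sup>2 = indicator A p *\<^sub>R (u p + c)\<^sup>2" for p
      by (simp add: indicator_def)
    ultimately show "set_borel_measurable lebesgue A (\<lambda>p. (u p + c)\<^sup>2)"
      unfolding set_borel_measurable_def by simp
    have "(u p + c)\<^sup>2 \<le> 2 * (u p)\<^sup>2 + 2 * c\<^sup>2" for p
      using zero_le_power2[of "u p - c"] by (simp add: power2_eq_square algebra_simps)
    then show "AE x in lebesgue. x \<in> A \<longrightarrow> norm ((u x + c)\<^sup>2) \<le> norm (2 * (u x)\<^sup>2 + 2 * c\<^sup>2)"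
      by (simp add: abs_of_nonneg)
  qed
  then show ?thesis using m by (simp add: L2_on_def)
qed

lemma L2_tendsto_add_const:
  fixes u :: "'a::euclidean_space \<Rightarrow> real"
  assumes "A \<in> lmeasurable" "L2_tendsto A w u"
  shows "L2_tendsto A (\<lambda>n p. w n p + c) (\<lambda>p. u p + c)"
  using assms L2_on_add_const by (auto simp: L2_tendsto_def)

lemma C1_grad_add_const: "C1_grad \<eta> D \<Longrightarrow> C1_grad (\<lambda>p. \<eta> p + c) D"
proof -
  assume \<eta>: "C1_grad \<eta> D"
  have "GDERIV (\<lambda>p. \<eta> p + c) p :> D p" for p
  proof -
    have "GDERIV \<eta> p :> D p" using \<eta> unfolding C1_grad_def by blast
    from GDERIV_add[OF this GDERIV_const[of c]] show ?thesis by simp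
  qed
  then show ?thesis using \<eta> unfolding C1_grad_def periodic_fst_def by simp
qed

section \<open>Vanishing integrals of test gradients and the addition of constants\<close>

lemma gderiv_partial:
  fixes \<eta> :: "real \<times> real \<Rightarrow> real"
  assumes "\<And>p. GDERIV \<eta> p :> D p"
  shows "((\<lambda>x. \<eta> (x, y)) has_real_derivative fst (D (x, y))) (at x within S)"
    and "((\<lambda>y. \<eta> (x, y)) has_real_derivative snd (D (x, y))) (at y within S)"
proof -
  have d: "(\<eta> has_derivative (\<lambda>h. h \<bullet> D (x, y))) (at (x, y))"
    using assms[of "(x, y)"] by (simp add: gderiv_def)
  have "((\<lambda>x. (x, y)) has_derivative (\<lambda>h. (h, 0))) (at x within S)"
    by (auto intro!: derivative_eq_intros)
  from has_derivative_compose[OF this d]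
  have "((\<lambda>x. \<eta> (x, y)) has_derivative (\<lambda>h. (h, 0) \<bullet> D (x, y))) (at x within S)" .
  also have "(\<lambda>h. (h, 0) \<bullet> D (x, y)) = (*) (fst (D (x, y)))"
    by (auto simp: fun_eq_iff inner_prod_def)
  finally show "((\<lambda>x. \<eta> (x, y)) has_real_derivative fst (D (x, y))) (at x within S)"
    by (simp only: has_field_derivative_def)
  have "((\<lambda>y. (x, y)) has_derivative (\<lambda>h. (0, h))) (at y within S)"
    by (auto intro!: derivative_eq_intros)
  from has_derivative_compose[OF this d]
  have "((\<lambda>y. \<eta> (x, y)) has_derivative (\<lambda>h. (0, h) \<bullet> D (x, y))) (at y within S)" .
  also have "(\<lambda>h. (0, h) \<bullet> D (x, y)) = (*) (snd (D (x, y)))"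
    by (auto simp: fun_eq_iff inner_prod_def)
  finally show "((\<lambda>y. \<eta> (x, y)) has_real_derivative snd (D (x, y))) (at y within S)"
    by (simp only: has_field_derivative_def)
qed

text \<open>By Fubini and the fundamental theorem of calculus: the horizontal component integrates
  to zero by periodicity, the vertical one by compact support. Consequently a constant added to a
  function does not affect its weak gradient.\<close>

lemma test_gradient_integral:
  assumes f: "continuous_on UNIV f" and test: "C1_test f \<eta> D"
  shows "set_integrable lebesgue (subgraph_cell f) D"
    and "(LINT p:subgraph_cell f|lebesgue. D p) = 0"
proof -
  from test obtain K where K: "compact K" "K \<subseteq> subgraph f"
    and supp: "\<And>x y. 0 \<le> x \<Longrightarrow> x \<le> 2 * pi \<Longrightarrow> \<eta> (x, y) \<noteq> 0 \<Longrightarrow> (x, y) \<in> K"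
    and C1: "C1_grad \<eta> D"
    unfolding C1_test_def by blast
  have der: "\<And>p. GDERIV \<eta> p :> D p" and cont: "continuous_on UNIV D"
    using C1 by (auto simp: C1_grad_def)
  obtain R where R: "R > 0" "\<And>p. p \<in> K \<Longrightarrow> norm p < R"
    using bounded_pos_less[THEN iffD1, OF compact_imp_bounded[OF K(1)]] by blast
  have Kbox: "\<bar>y\<bar> < R" if "(x, y) \<in> K" for x y
    using R(2)[OF that] norm_snd_le[of y x] by simp
  \<comment> \<open>The box replaces the domain under the graph: its height contains
    \<open>K\<close>, and \<open>D\<close> vanishes off \<open>K\<close> in the interior of the
    period, so both integrals of \<open>D\<close> agree.\<close>
  define Q where "Q = cbox (0, - R) (2 * pi, R)"
  have D0: "D (x, y) = 0" if "0 < x" "x < 2 * pi" "(x, y) \<notin> K" for x y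
  proof -
    define U where "U = {0<..<2 * pi} \<times> UNIV - K"
    have "open U" unfolding U_def
      by (intro open_Diff open_Times compact_imp_closed K) auto
    have "(x, y) \<in> U" using that by (simp add: U_def)
    have "GDERIV (\<lambda>_. 0) (x, y) :> D (x, y)"
      using der[of "(x, y)"] unfolding gderiv_def
    proof (rule has_derivative_transform_within_open[OF _ \<open>open U\<close> \<open>(x, y) \<in> U\<close>])
      show "\<eta> p = 0" if "p \<in> U" for p
        by (rule ccontr) (use that supp[of "fst p" "snd p"] in \<open>auto simp: U_def\<close>)
    qed
    then show ?thesis using GDERIV_const gderiv_unique by blast
  qed
  \<comment> \<open>Vanishing of the gradient was obtained on an open set, hence only strictly
    inside the period; the two vertical edges are discarded as null sets.\<close>
  have null: "{p :: real \<times> real. fst p = 0} \<in> null_sets lebesgue"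
    using negligible_standard_hyperplane[of "(1, 0) :: real \<times> real" 0]
    by (simp add: Basis_prod_def negligible_iff_null_sets inner_prod_def)
  have null2: "{p :: real \<times> real. fst p = 2 * pi} \<in> null_sets lebesgue"
    using negligible_standard_hyperplane[of "(1, 0) :: real \<times> real" "2 * pi"]
    by (simp add: Basis_prod_def negligible_iff_null_sets inner_prod_def)
  have ae: "AE p in lebesgue. indicator Q p *\<^sub>R D p = indicator (subgraph_cell f) p *\<^sub>R D p"
    using null[THEN AE_not_in] null2[THEN AE_not_in]
  proof eventually_elim
    case (elim p)
    obtain x y where p: "p = (x, y)" by (cases p)
    show ?case
    proof (cases "0 < x \<and> x < 2 * pi \<and> (x, y) \<in> K")
      case True
      then have "p \<in> Q" "p \<in> subgraph_cell f"
        using Kbox[of x y] K(2) by (auto simp: p Q_def cbox_Pair_eq subgraph_cell_def subgraph_def)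
      then show ?thesis by simp
    next
      case False
      then show ?thesis using elim D0[of x y]
        by (cases "0 < x \<and> x < 2 * pi") (auto simp: p Q_def cbox_Pair_eq subgraph_cell_def indicator_def)
    qed
  qed
  have DQ: "continuous_on Q D" using cont continuous_on_subset by blast
  have intQ: "set_integrable lebesgue Q D"
    using absolutely_integrable_continuous DQ unfolding Q_def by blast
  have meas: "(\<lambda>p. indicator (subgraph_cell f) p *\<^sub>R D p) \<in> borel_measurable lebesgue"
  proof -
    have "subgraph_cell f \<in> sets lebesgue"
      unfolding subgraph_cell_eq
      by (intro sets.Int[OF strip_fst_sets] sets_completionI_sets) (simp add: subgraph_open[OF f] borel_open)
    moreover have "D \<in> borel_measurable lebesgue"
      using borel_measurable_continuous_onI[OF cont] by (simp add: measurable_completion)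
    ultimately show ?thesis by (intro borel_measurable_scaleR borel_measurable_indicator)
  qed
  show "set_integrable lebesgue (subgraph_cell f) D"
    using intQ integrable_cong_AE[OF _ meas ae] unfolding set_integrable_def by auto
  have "(LINT p:subgraph_cell f|lebesgue. D p) = (LINT p:Q|lebesgue. D p)"
    unfolding set_lebesgue_integral_def using ae meas intQ
    by (intro integral_cong_AE) (auto simp: set_integrable_def elim: eventually_mono)
  also have "\<dots> = integral Q D"
    by (rule set_lebesgue_integral_eq_integral(2)[OF intQ])
  finally have eq: "(LINT p:subgraph_cell f|lebesgue. D p) = integral Q D" .
  have Dint: "D integrable_on Q" using intQ set_lebesgue_integral_eq_integral(1) by blast
  have fstD: "continuous_on S (\<lambda>p. fst (D p))" and sndD: "continuous_on S (\<lambda>p. snd (D p))" for S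
    using continuous_on_subset[OF cont, of S] by (auto intro: continuous_on_fst continuous_on_snd)
  \<comment> \<open>The order of integration is exchanged here so that the horizontal derivative is
    integrated first, over a full period.\<close>
  have "integral Q (\<lambda>p. fst (D p)) = integral {- R..R} (\<lambda>y. integral {0..2 * pi} (\<lambda>x. fst (D (x, y))))"
    using integral_prod_continuous[where a=0 and c="- R" and b="2 * pi" and d=R and f="\<lambda>p. fst (D p)"]
      integral_swap_continuous[where a=0 and c="- R" and b="2 * pi" and d=R and f= "\<lambda>x y. fst (D (x, y))"] fstD
    by (simp add: Q_def)
  moreover have "integral {0..2 * pi} (\<lambda>x. fst (D (x, y))) = 0" for y
  proof -
    have "((\<lambda>x. fst (D (x, y))) has_integral \<eta> (2 * pi, y) - \<eta> (0, y)) {0..2 * pi}"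
      using gderiv_partial(1)[OF der]
      by (intro fundamental_theorem_of_calculus) (auto simp: has_real_derivative_iff_has_vector_derivative)
    moreover have "\<eta> (2 * pi, y) = \<eta> (0, y)"
      using C1_grad_periodic(1)[OF C1, of "(0, y)"] by simp
    ultimately show ?thesis by (simp add: integral_unique)
  qed
  ultimately have 1: "integral Q (\<lambda>p. fst (D p)) = 0" by simp
  have "integral Q (\<lambda>p. snd (D p)) = integral {0..2 * pi} (\<lambda>x. integral {- R..R} (\<lambda>y. snd (D (x, y))))"
    using integral_prod_continuous[where a=0 and c="- R" and b="2 * pi" and d=R and f="\<lambda>p. snd (D p)"] sndD
    by (simp add: Q_def)
  also have "\<dots> = integral {0..2 * pi} (\<lambda>x. 0 :: real)"
  proof (rule Henstock_Kurzweil_Integration.integral_cong)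
    fix x assume x: "x \<in> {0..2 * pi}"
    have "((\<lambda>y. snd (D (x, y))) has_integral \<eta> (x, R) - \<eta> (x, - R)) {- R..R}"
      using gderiv_partial(2)[OF der] R(1)
      by (intro fundamental_theorem_of_calculus) (auto simp: has_real_derivative_iff_has_vector_derivative)
    \<comment> \<open>The bound \<open>R\<close> is strict on \<open>K\<close>, so the top and
      bottom edges of the box lie outside the support.\<close>
    moreover have "\<eta> (x, R) = 0" "\<eta> (x, - R) = 0"
      using supp[of x R] supp[of x "- R"] Kbox[of x R] Kbox[of x "- R"] x R(1) by force+
    ultimately show "integral {- R..R} (\<lambda>y. snd (D (x, y))) = 0" by (simp add: integral_unique)
  qed
  finally have 2: "integral Q (\<lambda>p. snd (D p)) = 0" by simp
  have "integral Q D = (integral Q (\<lambda>p. fst (D p)), integral Q (\<lambda>p. snd (D p)))"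
    using integral_linear[OF Dint bounded_linear_fst] integral_linear[OF Dint bounded_linear_snd]
    by (simp add: o_def prod_eq_iff)
  then show "(LINT p:subgraph_cell f|lebesgue. D p) = 0"
    by (simp add: eq 1 2 zero_prod_def)
qed

text \<open>The same gradient \<open>V\<close> serves both functions. The only new term in the weak
  formulation is \<open>c\<close> times the integral of a test gradient, which is zero.\<close>

lemma harmonic_extension_add_const:
  assumes f: "continuous_on UNIV f" and H: "harmonic_extension f g \<phi>"
  shows "harmonic_extension f (\<lambda>x. g x + c) (\<lambda>p. \<phi> p + c)"
proof -
  obtain V where V: "weak_gradient f \<phi> V" "L2_on (subgraph_cell f) V" "has_trace f \<phi> V g"
    and harm: "\<forall>\<eta> D. C1_test f \<eta> D \<longrightarrow> (LINT p:subgraph_cell f|lebesgue. V p \<bullet> D p) = 0"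
    using H unfolding harmonic_extension_def by blast
  have "(LINT p:subgraph_cell f|lebesgue. (\<phi> p + c) *\<^sub>R D p) =
      (LINT p:subgraph_cell f|lebesgue. \<phi> p *\<^sub>R D p)" if "C1_test f \<eta> D" for \<eta> D
  proof -
    note I = test_gradient_integral[OF f that]
    have c: "set_integrable lebesgue (subgraph_cell f) (\<lambda>p. c *\<^sub>R D p)"
      using I(1) by simp
    show ?thesis
    \<comment> \<open>The two integrands differ by the integrable function
      \<open>c *\<^sub>R D p\<close>, so they are integrable together; if neither is, both integrals
      are 0 by default.\<close>
    proof (cases "set_integrable lebesgue (subgraph_cell f) (\<lambda>p. \<phi> p *\<^sub>R D p)")
      case True
      then show ?thesis using set_integral_add(2)[OF True c] I(2)
        by (simp add: scaleR_add_left)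
    next
      case False
      have "\<not> set_integrable lebesgue (subgraph_cell f) (\<lambda>p. (\<phi> p + c) *\<^sub>R D p)"
      proof
        assume "set_integrable lebesgue (subgraph_cell f) (\<lambda>p. (\<phi> p + c) *\<^sub>R D p)"
        from set_integral_diff(1)[OF this c] False show False
          by (simp add: scaleR_add_left)
      qed
      then show ?thesis using False
        by (simp add: set_integrable_def set_lebesgue_integral_def not_integrable_integral_eq)
    qed
  qed
  then have "weak_gradient f (\<lambda>p. \<phi> p + c) V"
    using V(1) unfolding weak_gradient_def by simp
  moreover have "has_trace f (\<lambda>p. \<phi> p + c) V (\<lambda>x. g x + c)"
  proof -
    obtain w D where C1: "\<And>n. C1_grad (w n) (D n)"
      and w: "\<And>m. L2_tendsto (subgraph_cell f \<inter> {p. m < snd p}) w \<phi>"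
      and D: "\<And>m. L2_tendsto (subgraph_cell f \<inter> {p. m < snd p}) D V"
      and tr: "L2_tendsto {0..<2 * pi} (\<lambda>n x. w n (x, f x)) g"
      using V(3) unfolding has_trace_def by blast
    have "{0..<2 * pi} \<in> lmeasurable"
      by (intro bounded_set_imp_lmeasurable) auto
    then have "L2_tendsto {0..<2 * pi} (\<lambda>n x. w n (x, f x) + c) (\<lambda>x. g x + c)"
      using tr by (rule L2_tendsto_add_const)
    then show ?thesis
      unfolding has_trace_def
      using C1_grad_add_const[OF C1] L2_tendsto_add_const[OF subgraph_cell_truncated[OF f] w] D
      by (intro exI[of _ "\<lambda>n p. w n p + c"] exI[of _ D]) simp
  qed
  ultimately show ?thesis
    using H V(2) harm unfolding harmonic_extension_def
    by (auto simp: periodic_fst_def intro!: continuous_intros)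
qed

section \<open>Invariance of the Dirichlet-Neumann operator\<close>

definition dn_limit :: "(real \<Rightarrow> real) \<Rightarrow> real \<Rightarrow> real \<Rightarrow> bool" where
  "dn_limit f x l \<longleftrightarrow> (\<exists>\<phi>. harmonic_extension f f \<phi> \<and>
     ((\<lambda>h. (\<phi> ((x, f x) + h *\<^sub>R normal_vec f x) - \<phi> (x, f x)) / h) \<longlongrightarrow> l) (at_left 0))"

lemma C11_shift:
  assumes "C11 w"
  shows "C11 (\<lambda>x. w (x + a) + c)" "deriv (\<lambda>x. w (x + a) + c) x = deriv w (x + a)"
proof -
  have *: "((\<lambda>x. w (x + a) + c) has_real_derivative deriv w (x + a)) (at x)" for x
  proof -
    have "(w has_real_derivative deriv w (x + a)) (at (x + a))"
      using assms by (simp add: C11_def differentiable_def DERIV_deriv_iff_real_differentiable)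
    then show ?thesis
      by (auto intro!: derivative_eq_intros simp: DERIV_shift)
  qed
  show d: "deriv (\<lambda>x. w (x + a) + c) x = deriv w (x + a)" for x
    by (rule DERIV_imp_deriv[OF *])
  obtain L where "L-lipschitz_on UNIV (deriv w)" using assms by (auto simp: C11_def)
  then have "L-lipschitz_on UNIV (\<lambda>x. deriv w (x + a))"
    by (simp add: lipschitz_on_def dist_real_def) (metis add_diff_cancel_right)
  moreover have "periodic (\<lambda>x. w (x + a) + c)"
    using periodic_translate[of w a] assms by (simp add: C11_def periodic_def)
  ultimately show "C11 (\<lambda>x. w (x + a) + c)"
    using * by (auto simp: C11_def d[abs_def] real_differentiable_def)
qed

text \<open>The extension is translated and raised by \<open>c\<close>. The normal vector is
  translated with the profile and the constant cancels in the difference quotient, which is thus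
  literally the same function of \<open>h\<close>.\<close>

lemma dn_limit_shift:
  assumes w: "C11 w" and l: "dn_limit w (x + a) l"
  shows "dn_limit (\<lambda>x. w (x + a) + c) x l"
proof -
  let ?w = "\<lambda>x. w (x + a) + c"
  obtain \<phi> where H: "harmonic_extension w w \<phi>"
    and lim: "((\<lambda>h. (\<phi> ((x + a, w (x + a)) + h *\<^sub>R normal_vec w (x + a)) - \<phi> (x + a, w (x + a))) / h) \<longlongrightarrow> l) (at_left 0)"
    using l unfolding dn_limit_def by blast
  have per: "periodic w" using w by (simp add: C11_def)
  have "harmonic_extension ?w ?w (\<lambda>p. \<phi> (p + (a, -c)) + c)"
    by (rule harmonic_extension_add_const[OF C11_continuous[OF C11_shift(1)[OF w]]
          harmonic_extension_translate[OF per per H]])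
  moreover have n: "normal_vec ?w x = normal_vec w (x + a)"
    by (simp add: normal_vec_def C11_shift(2)[OF w])
  moreover have eq: "(\<phi> ((x, ?w x) + h *\<^sub>R normal_vec ?w x + (a, -c)) + c - (\<phi> ((x, ?w x) + (a, -c)) + c)) / h =
      (\<phi> ((x + a, w (x + a)) + h *\<^sub>R normal_vec w (x + a)) - \<phi> (x + a, w (x + a))) / h" for h
  proof -
    have "(x, ?w x) + h *\<^sub>R normal_vec w (x + a) + (a, -c) = (x + a, w (x + a)) + h *\<^sub>R normal_vec w (x + a)"
      by (simp add: prod_eq_iff)
    moreover have "(x, ?w x) + (a, -c) = (x + a, w (x + a))" by simp
    ultimately show ?thesis by (simp only: n add_diff_cancel_right)
  qed
  ultimately show ?thesis
    unfolding dn_limit_def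
    by (intro exI[of _ "\<lambda>p. \<phi> (p + (a, -c)) + c"] conjI) (simp_all only: eq lim)
qed

lemma dirichlet_neumann_eq: "dirichlet_neumann f f x = (THE l. dn_limit f x l)"
  by (simp add: dirichlet_neumann_def dn_limit_def)

text \<open>The candidates \<open>l\<close> for the limit are the same on both sides, so the two
  definite descriptions coincide, whatever they denote.\<close>

lemma dirichlet_neumann_shift:
  assumes w: "C11 w"
  shows "dirichlet_neumann (\<lambda>x. w (x + a) + c) (\<lambda>x. w (x + a) + c) x = dirichlet_neumann w w (x + a)"
proof -
  \<comment> \<open>The converse implication shifts back by \<open>- a\<close> and
    \<open>- c\<close>.\<close>
  have "dn_limit (\<lambda>x. w (x + a) + c) x l \<longleftrightarrow> dn_limit w (x + a) l" for l
    using dn_limit_shift[OF w, of x a l c]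
      dn_limit_shift[OF C11_shift(1)[OF w, of a c], of "x + a" "- a" l "- c"] by auto
  then have "dn_limit (\<lambda>x. w (x + a) + c) x = dn_limit w (x + a)" by blast
  then show ?thesis
    unfolding dirichlet_neumann_eq by simp
qed


section \<open>Interposition of a function with Lipschitz derivative\<close>

lemma convex_on_subgradient:
  fixes f :: "real \<Rightarrow> real"
  assumes "convex_on UNIV f"
  obtains p where "\<And>y. f z + p * (y - z) \<le> f y"
  using convex_le_Inf_differential[OF assms, of z] by auto

text \<open>Otherwise the test \<open>d = a / D\<close>, with \<open>D\<close> positive and larger
  than \<open>C\<close>, makes the linear term win.\<close>

lemma linear_le_square_imp_zero:
  fixes a C :: real
  assumes "\<And>d. a * d \<le> C * d\<^sup>2" shows "a = 0"
proof (rule ccontr)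
  assume "a \<noteq> 0"
  define D where "D = \<bar>C\<bar> + 1"
  have D: "D > 0" "C < D" by (auto simp: D_def)
  have "a * (a / D) \<le> C * (a / D)\<^sup>2" by (rule assms)
  then have "a\<^sup>2 * D \<le> C * a\<^sup>2"
    using D by (simp add: power2_eq_square field_simps)
  moreover have "C * a\<^sup>2 < D * a\<^sup>2" using D \<open>a \<noteq> 0\<close> by simp
  ultimately show False by (simp add: mult.commute)
qed

text \<open>The quadratic error identifies \<open>P z\<close> as the derivative at \<open>z\<close>.
  Adding the expansions at two points with their roles exchanged bounds the difference of slopes by
  \<open>2 * K\<close> times the distance.\<close>

lemma C11_if_quadratic_expansion:
  assumes per: "periodic h"
    and exp: "\<And>z. \<exists>P. \<forall>y. \<bar>h y - h z - P * (y - z)\<bar> \<le> K * (y - z)\<^sup>2"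
  shows "C11 h"
proof -
  obtain P where P: "\<And>z y. \<bar>h y - h z - P z * (y - z)\<bar> \<le> K * (y - z)\<^sup>2"
    using exp by metis
  have K: "0 \<le> K" using P[of 1 0] by simp
  have der: "(h has_real_derivative P z) (at z)" for z
    unfolding DERIV_def
  proof (rule LIM_zero_cancel, rule Lim_null_comparison)
    have "norm ((h (z + d) - h z) / d - P z) \<le> K * \<bar>d\<bar>" if "d \<noteq> 0" for d
    proof -
      have "\<bar>(h (z + d) - h z) / d - P z\<bar> = \<bar>h (z + d) - h z - P z * d\<bar> / \<bar>d\<bar>"
        using that by (simp add: field_simps flip: abs_divide)
      also have "\<dots> \<le> (K * d\<^sup>2) / \<bar>d\<bar>"
        using P[of "z + d" z] by (intro divide_right_mono) auto
      also have "\<dots> = K * \<bar>d\<bar>"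
        using that by (simp add: field_simps power2_eq_square)
      finally show ?thesis by simp
    qed
    then show "\<forall>\<^sub>F d in at 0. norm ((h (z + d) - h z) / d - P z) \<le> K * \<bar>d\<bar>"
      by (auto simp: eventually_at intro: exI[of _ 1])
    have "((\<lambda>d. K * \<bar>d\<bar>) \<longlongrightarrow> K * \<bar>0\<bar>) (at 0)"
      by (intro tendsto_intros)
    then show "((\<lambda>d. K * \<bar>d\<bar>) \<longlongrightarrow> 0) (at 0)" by simp
  qed
  have "\<bar>P x - P y\<bar> \<le> 2 * K * \<bar>x - y\<bar>" for x y
  proof (cases "x = y")
    case False
    have "\<bar>(P x - P y) * (x - y)\<bar> \<le> 2 * K * (x - y)\<^sup>2"
      using P[of x y] P[of y x] unfolding abs_le_iff
      by (simp add: power2_eq_square algebra_simps)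
    then have "\<bar>P x - P y\<bar> * \<bar>x - y\<bar> \<le> (2 * K * \<bar>x - y\<bar>) * \<bar>x - y\<bar>"
      by (simp add: abs_mult power2_eq_square)
    then show ?thesis using False by (simp add: mult_le_cancel_right)
  qed simp
  moreover have "deriv h = P" using der by (auto intro: DERIV_imp_deriv)
  ultimately have "(2 * K)-lipschitz_on UNIV (deriv h)"
    using K by (auto simp: lipschitz_on_def dist_real_def)
  then show ?thesis
    using per der by (auto simp: C11_def real_differentiable_def)
qed

text \<open>The two convex functions add up to \<open>2 * K * z\<^sup>2\<close>, whose slope is
  \<open>4 * K * z\<close>. This ties their subgradients together, and the two supporting lines
  become the lower and upper halves of a quadratic expansion of \<open>h\<close> with slope
  \<open>p - 2 * K * z\<close>.\<close>

lemma C11_if_semiconvex_semiconcave: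
  assumes per: "periodic h"
    and A: "convex_on UNIV (\<lambda>z. h z + K * z\<^sup>2)" and B: "convex_on UNIV (\<lambda>z. K * z\<^sup>2 - h z)"
  shows "C11 h"
proof (rule C11_if_quadratic_expansion[OF per])
  fix z
  obtain p where p: "\<And>y. h z + K * z\<^sup>2 + p * (y - z) \<le> h y + K * y\<^sup>2"
    using convex_on_subgradient[OF A, of z] by blast
  obtain q where q: "\<And>y. K * z\<^sup>2 - h z + q * (y - z) \<le> K * y\<^sup>2 - h y"
    using convex_on_subgradient[OF B, of z] by blast
  have "(p + q - 4 * K * z) * d \<le> 2 * K * d\<^sup>2" for d
    using p[of "z + d"] q[of "z + d"] by (simp add: power2_eq_square algebra_simps)
  then have "p + q - 4 * K * z = 0" by (rule linear_le_square_imp_zero)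
  then have q': "q = 4 * K * z - p" by simp
  have "\<bar>h y - h z - (p - 2 * K * z) * (y - z)\<bar> \<le> K * (y - z)\<^sup>2" for y
    using p[of y] q[of y] unfolding q' by (simp add: abs_le_iff power2_eq_square algebra_simps)
  then show "\<exists>P. \<forall>y. \<bar>h y - h z - P * (y - z)\<bar> \<le> K * (y - z)\<^sup>2" by blast
qed

text \<open>This lets a weighted inequality pass to the infimum in one variable at a time; dividing
  by a positive weight gives a uniform lower bound for \<open>g\<close>.\<close>

lemma le_mult_cINF:
  fixes g :: "real \<Rightarrow> real"
  assumes "0 \<le> u" "\<And>y. C \<le> u * g y" shows "C \<le> u * (INF y. g y)"
proof (cases "u = 0")
  case False
  with assms(1) have u: "0 < u" by simp
  have "C / u \<le> (INF y. g y)"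
    using assms(2) u by (intro cINF_greatest) (auto simp: divide_le_eq mult.commute)
  then show ?thesis using u by (simp add: divide_le_eq mult.commute)
qed (use assms(2)[of 0] in simp)

text \<open>Ilmanen's interposition: the inf-convolution of the sup-convolution of \<open>a\<close>, with a doubled
  coefficient, is both semiconvex and semiconcave.\<close>

lemma C11_interposition:
  fixes a b :: "real \<Rightarrow> real"
  assumes k: "0 \<le> k" and per: "periodic a" and ab: "\<And>x y. a x - b y \<le> k * (x - y)\<^sup>2"
  obtains h where "C11 h" "\<And>x z. a x \<le> h z + 2 * k * (x - z)\<^sup>2" "\<And>y z. h z \<le> b y + 2 * k * (y - z)\<^sup>2"
proof -
  define F where "F y = (SUP x. a x - k * (x - y)\<^sup>2)" for y
  define h where "h z = (INF y. F y + 2 * k * (z - y)\<^sup>2)" for z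
  have bdd: "bdd_above (range (\<lambda>x. a x - k * (x - y)\<^sup>2))" for y
    using ab[of _ y] by (intro bdd_aboveI[of _ "b y"]) (auto simp: algebra_simps)
  have aF: "a x - k * (x - y)\<^sup>2 \<le> F y" for x y
    unfolding F_def by (rule cSUP_upper[OF _ bdd]) simp
  have Fb: "F y \<le> b y" for y
    unfolding F_def using ab[of _ y] by (intro cSUP_least) (auto simp: algebra_simps)
  \<comment> \<open>Passing from \<open>x\<close> to \<open>y\<close> through \<open>z\<close> at
    most doubles the sum of the squared distances, which is paid for by the doubled
    coefficient.\<close>
  have aFF: "a x - 2 * k * (x - z)\<^sup>2 \<le> F y + 2 * k * (z - y)\<^sup>2" for x y z
  proof -
    have "(x - y)\<^sup>2 \<le> 2 * (x - z)\<^sup>2 + 2 * (z - y)\<^sup>2"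
      using zero_le_power2[of "(x - z) - (z - y)"] by (simp add: power2_eq_square algebra_simps)
    from mult_left_mono[OF this k] aF[of x y] show ?thesis by (simp add: algebra_simps)
  qed
  have bdd': "bdd_below (range (\<lambda>y. F y + 2 * k * (z - y)\<^sup>2))" for z
    using aFF[of 0 z] by (intro bdd_belowI[of _ "a 0 - 2 * k * (0 - z)\<^sup>2"]) auto
  have hF: "h z \<le> F y + 2 * k * (z - y)\<^sup>2" for y z
    unfolding h_def by (rule cINF_lower[OF bdd']) simp
  \<comment> \<open>Extrema over the whole line are unchanged when the variable is shifted by a
    period, so both convolutions inherit periodicity.\<close>
  have shift: "range (\<lambda>x. g (x + 2 * pi)) = range g" for g :: "real \<Rightarrow> real"
  proof -
    have "g x \<in> range (\<lambda>x. g (x + 2 * pi))" for x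
      by (rule image_eqI[of _ _ "x - 2 * pi"]) auto
    then show ?thesis by auto
  qed
  have Fper: "F (y + 2 * pi) = F y" for y
    unfolding F_def using shift[of "\<lambda>x. a x - k * (x - (y + 2 * pi))\<^sup>2"] per
    by (simp add: periodic_def)
  have hper: "periodic h"
    unfolding periodic_def
  proof
    fix z show "h (z + 2 * pi) = h z"
      unfolding h_def using shift[of "\<lambda>y. F y + 2 * k * (z + 2 * pi - y)\<^sup>2"]
      by (simp add: Fper)
  qed
  \<comment> \<open>Semiconvexity of \<open>F\<close>: each parabola satisfies the relation with
    equality, and the supremum inherits the inequality.\<close>
  have Fconv: "F ((1 - t) * y + t * y') \<le> (1 - t) * F y + t * F y' + k * (t * (1 - t)) * (y - y')\<^sup>2"
    if t: "0 < t" "t < 1" for t y y'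
    unfolding F_def[of "(1 - t) * y + t * y'"]
  proof (rule cSUP_least)
    fix x
    have "a x - k * (x - ((1 - t) * y + t * y'))\<^sup>2 =
        (1 - t) * (a x - k * (x - y)\<^sup>2) + t * (a x - k * (x - y')\<^sup>2) + k * (t * (1 - t)) * (y - y')\<^sup>2"
      by (simp add: power2_eq_square algebra_simps)
    also have "\<dots> \<le> (1 - t) * F y + t * F y' + k * (t * (1 - t)) * (y - y')\<^sup>2"
      using t by (intro add_right_mono add_mono mult_left_mono aF) auto
    finally show "a x - k * (x - ((1 - t) * y + t * y'))\<^sup>2 \<le>
      (1 - t) * F y + t * F y' + k * (t * (1 - t)) * (y - y')\<^sup>2" .
  qed simp
  have "convex_on UNIV (\<lambda>z. h z + 2 * k * z\<^sup>2)"
  proof (rule convex_onI)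
    fix t z w :: real assume t: "0 < t" "t < 1"
    let ?m = "(1 - t) * z + t * w" and ?e = "2 * k * (t * (1 - t)) * (z - w)\<^sup>2"
    \<comment> \<open>The parabola with coefficient \<open>2 * k\<close> gains a multiple of
      \<open>(?r - ?s)\<^sup>2\<close>. This absorbs the semiconvexity error of \<open>F\<close>, a
      multiple of \<open>?s\<^sup>2\<close>, up to a multiple of \<open>?r\<^sup>2\<close>, which is
      exactly \<open>?e\<close>.\<close>
    have "h ?m - ?e \<le> (1 - t) * (F y + 2 * k * (z - y)\<^sup>2) + t * (F y' + 2 * k * (w - y')\<^sup>2)" for y y'
    proof -
      let ?r = "z - w" and ?s = "y - y'"
      have "?s\<^sup>2 \<le> 2 * ?r\<^sup>2 + 2 * (?r - ?s)\<^sup>2"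
        using zero_le_power2[of "2 * ?r - ?s"] by (simp add: power2_eq_square algebra_simps)
      moreover have "0 \<le> k * (t * (1 - t))"
        using t by (intro mult_nonneg_nonneg k) auto
      ultimately have "k * (t * (1 - t)) * ?s\<^sup>2 \<le> k * (t * (1 - t)) * (2 * ?r\<^sup>2 + 2 * (?r - ?s)\<^sup>2)"
        by (rule mult_left_mono)
      moreover have "2 * k * (?m - ((1 - t) * y + t * y'))\<^sup>2 = (1 - t) * (2 * k * (z - y)\<^sup>2) +
          t * (2 * k * (w - y')\<^sup>2) - 2 * k * (t * (1 - t)) * (?r - ?s)\<^sup>2"
        by (simp add: power2_eq_square algebra_simps)
      ultimately show ?thesis
        using hF[of ?m "(1 - t) * y + t * y'"] Fconv[OF t, of y y'] by (simp add: algebra_simps)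
    qed
    \<comment> \<open>The infima defining \<open>h z\<close> and \<open>h w\<close> are now taken
      one after the other, over \<open>y\<close> and then over \<open>y'\<close>.\<close>
    then have "h ?m - ?e - t * (F y' + 2 * k * (w - y')\<^sup>2) \<le> (1 - t) * (F y + 2 * k * (z - y)\<^sup>2)" for y y'
      by (simp add: algebra_simps)
    then have "h ?m - ?e - t * (F y' + 2 * k * (w - y')\<^sup>2) \<le> (1 - t) * h z" for y'
      unfolding h_def[of z] using t by (intro le_mult_cINF) auto
    then have "h ?m - ?e - (1 - t) * h z \<le> t * (F y' + 2 * k * (w - y')\<^sup>2)" for y'
      by (simp add: algebra_simps)
    then have "h ?m - ?e - (1 - t) * h z \<le> t * h w"
      unfolding h_def[of w] using t by (intro le_mult_cINF) auto
    then show "h ((1 - t) *\<^sub>R z + t *\<^sub>R w) + 2 * k * ((1 - t) *\<^sub>R z + t *\<^sub>R w)\<^sup>2 \<le>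
        (1 - t) * (h z + 2 * k * z\<^sup>2) + t * (h w + 2 * k * w\<^sup>2)"
      by (simp add: power2_eq_square algebra_simps)
  qed simp
  \<comment> \<open>As an infimum of translated parabolas with leading coefficient
    \<open>2 * k\<close>, \<open>h\<close> turns into a supremum of affine functions when subtracted
    from \<open>2 * k * z\<^sup>2\<close>.\<close>
  moreover have "convex_on UNIV (\<lambda>z. 2 * k * z\<^sup>2 - h z)"
  proof (rule convex_onI)
    fix t z w :: real assume t: "0 < t" "t < 1"
    let ?m = "(1 - t) * z + t * w" and ?e = "2 * k * (t * (1 - t)) * (z - w)\<^sup>2"
    have "(1 - t) * h z + t * h w - ?e \<le> h ?m"
      unfolding h_def[of ?m]
    proof (rule cINF_greatest)
      fix y
      have "(1 - t) * h z + t * h w \<le>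
          (1 - t) * (F y + 2 * k * (z - y)\<^sup>2) + t * (F y + 2 * k * (w - y)\<^sup>2)"
        using t by (intro add_mono mult_left_mono hF) auto
      also have "\<dots> = F y + 2 * k * (?m - y)\<^sup>2 + ?e"
        by (simp add: power2_eq_square algebra_simps)
      finally show "(1 - t) * h z + t * h w - ?e \<le> F y + 2 * k * (?m - y)\<^sup>2" by simp
    qed simp
    then show "2 * k * ((1 - t) *\<^sub>R z + t *\<^sub>R w)\<^sup>2 - h ((1 - t) *\<^sub>R z + t *\<^sub>R w) \<le>
        (1 - t) * (2 * k * z\<^sup>2 - h z) + t * (2 * k * w\<^sup>2 - h w)"
      by (simp add: power2_eq_square algebra_simps)
  qed simp
  ultimately have "C11 h" by (rule C11_if_semiconvex_semiconcave[OF hper])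
  moreover have "a x \<le> h z + 2 * k * (x - z)\<^sup>2" for x z
  proof -
    have "a x - 2 * k * (x - z)\<^sup>2 \<le> h z"
      unfolding h_def by (rule cINF_greatest) (auto intro: aFF)
    then show ?thesis by simp
  qed
  moreover have "h z \<le> b y + 2 * k * (y - z)\<^sup>2" for y z
    using hF[of z y] Fb[of y] by (simp add: power2_commute)
  ultimately show ?thesis using that by blast
qed


section \<open>Contradiction at an interior maximum\<close>

lemma C11_norm_const: "C11_norm (\<lambda>x. c) = \<bar>c\<bar>"
proof -
  have "{\<bar>deriv (\<lambda>_. c) x - deriv (\<lambda>_. c) y\<bar> / \<bar>x - y\<bar> | x y. x \<noteq> y} = {0 :: real}"
    using zero_neq_one[where ?'a = real] by auto
  then show ?thesis by (simp add: C11_norm_def)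
qed

text \<open>Two time slices differ by a constant in space, so the \<open>C11_norm\<close> of their
  difference is \<open>\<bar>q t - q s\<bar>\<close> and continuity in time is that of
  \<open>q\<close>.\<close>

lemma test_function_separated:
  assumes h: "C11 h" and q: "\<And>t. t \<in> {0<..<T} \<Longrightarrow> (q has_real_derivative q' t) (at t)"
    and q': "continuous_on {0<..<T} q'"
  shows "test_function T (\<lambda>x t. h x + q t)"
    and "t \<in> {0<..<T} \<Longrightarrow> deriv (\<lambda>t. h x + q t) t = q' t"
proof -
  have der: "((\<lambda>t. h x + q t) has_real_derivative q' t) (at t)" if "t \<in> {0<..<T}" for x t
    using q[OF that] by (auto intro!: derivative_eq_intros)
  show deriv: "deriv (\<lambda>t. h x + q t) t = q' t" if "t \<in> {0<..<T}" for x t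
    using der[OF that] by (rule DERIV_imp_deriv)
  have "continuous_on (UNIV \<times> {0<..<T}) (\<lambda>p. q' (snd p))"
    by (rule continuous_on_compose2[OF q' continuous_on_snd[OF continuous_on_id]]) auto
  then have "continuous_on (UNIV \<times> {0<..<T}) (\<lambda>(x, t). deriv (\<lambda>t. h x + q t) t)"
    by (rule continuous_on_eq) (auto simp: deriv)
  moreover have "C11 (\<lambda>x. h x + q t)" for t
    using C11_shift(1)[OF h, of 0 "q t"] by simp
  moreover have "((\<lambda>t. C11_norm (\<lambda>x. (h x + q t) - (h x + q s))) \<longlongrightarrow> 0) (at s)"
    if "s \<in> {0<..<T}" for s
  proof -
    have "(q \<longlongrightarrow> q s) (at s)" using q[OF that] DERIV_isCont isContD by blast
    then have "((\<lambda>t. \<bar>q t - q s\<bar>) \<longlongrightarrow> \<bar>q s - q s\<bar>) (at s)" by (intro tendsto_intros)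
    then show ?thesis by (simp add: C11_norm_const)
  qed
  moreover have "(\<lambda>t. h x + q t) differentiable (at t)" if "t \<in> {0<..<T}" for x t
    using der[OF that] real_differentiable_def by blast
  ultimately show "test_function T (\<lambda>x t. h x + q t)"
    unfolding test_function_def by blast
qed

text \<open>With a common slope \<open>p\<close> and a common operator value \<open>G\<close>, the
  two viscosity inequalities give \<open>\<mu> / (T - s0)\<^sup>2 + p \<le> - \<kappa> * G\<close>
  and \<open>- \<kappa> * G \<le> p - \<mu> / (T - s1)\<^sup>2\<close>, which is impossible for
  positive \<mu>.\<close>

lemma no_interior_maximum:
  fixes f g :: "real \<Rightarrow> real \<Rightarrow> real"
  assumes sub: "viscosity_subsolution \<kappa> T f" and super: "viscosity_supersolution \<kappa> T g"
    and \<mu>: "0 < \<mu>" and k: "0 \<le> k" and s0: "0 < s0" "s0 < T" and s1: "0 < s1" "s1 < T"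
    and max: "\<And>x y t s. 0 \<le> t \<Longrightarrow> t < T \<Longrightarrow> 0 \<le> s \<Longrightarrow> s < T \<Longrightarrow>
      f x t - \<mu> / (T - t) - (g y s + \<mu> / (T - s)) - k * (x - y)\<^sup>2 - k * (t - s)\<^sup>2 \<le>
      f x0 s0 - \<mu> / (T - s0) - (g y0 s1 + \<mu> / (T - s1)) - k * (x0 - y0)\<^sup>2 - k * (s0 - s1)\<^sup>2"
  shows False
proof -
  define p where "p = 2 * k * (s0 - s1)"
  \<comment> \<open>This is the maximal value without its time coupling. Adding it to
    \<open>B\<close> makes the difference of \<open>A\<close> and \<open>B\<close> at the maximum
    equal to \<open>k * (x0 - y0)\<^sup>2\<close>.\<close>
  define M where "M = f x0 s0 - \<mu> / (T - s0) - (g y0 s1 + \<mu> / (T - s1)) - k * (x0 - y0)\<^sup>2"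
  define A where "A x t = f x t - \<mu> / (T - t) - p * (t - s0) - 2 * k * (t - s0)\<^sup>2" for x t
  define B where "B y s = g y s + \<mu> / (T - s) - p * (s - s1) + 2 * k * (s - s1)\<^sup>2 + M" for y s
  \<comment> \<open>Times up to \<open>s0\<close> and \<open>s1\<close> suffice, as the viscosity
    tests look backwards in time.\<close>
  define a where "a x = (SUP t\<in>{0..s0}. A x t)" for x
  define b where "b y = (INF s\<in>{0..s1}. B y s)" for y
  \<comment> \<open>The quadratic coupling in time splits because the square of a difference is at most twice the
    sum of the squares; \<open>p\<close> is its slope at the maximum.\<close>
  have AB: "A x t - B y s \<le> k * (x - y)\<^sup>2" if "t \<in> {0..s0}" "s \<in> {0..s1}" for x y t s
  proof -
    have "0 \<le> k * ((t - s0) + (s - s1))\<^sup>2" using k by simp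
    then have "k * (t - s)\<^sup>2 \<le> k * (s0 - s1)\<^sup>2 + p * (t - s0) - p * (s - s1)
        + 2 * k * (t - s0)\<^sup>2 + 2 * k * (s - s1)\<^sup>2"
      unfolding p_def by (simp add: power2_eq_square algebra_simps)
    then show ?thesis
      using max[of t s x y] that s0 s1 unfolding A_def B_def M_def by simp
  qed
  have bddA: "bdd_above (A x ` {0..s0})" for x
    using AB[of _ s1 x y0] s1 by (intro bdd_aboveI[of _ "k * (x - y0)\<^sup>2 + B y0 s1"]) (auto simp: algebra_simps)
  have bddB: "bdd_below (B y ` {0..s1})" for y
    using AB[of s0 _ x0 y] s0 by (intro bdd_belowI[of _ "A x0 s0 - k * (x0 - y)\<^sup>2"]) (auto simp: algebra_simps)
  have Aa: "A x t \<le> a x" if "t \<in> {0..s0}" for x t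
    unfolding a_def by (rule cSUP_upper[OF that bddA])
  have bB: "b y \<le> B y s" if "s \<in> {0..s1}" for y s
    unfolding b_def by (rule cINF_lower[OF bddB that])
  have ab: "a x - b y \<le> k * (x - y)\<^sup>2" for x y
  proof -
    have "a x \<le> k * (x - y)\<^sup>2 + B y s" if "s \<in> {0..s1}" for s
      unfolding a_def using AB[OF _ that, of _ x y] s0 by (intro cSUP_least) (auto simp: algebra_simps)
    then have "a x - k * (x - y)\<^sup>2 \<le> b y"
      unfolding b_def using s1 by (intro cINF_greatest) (auto simp: algebra_simps)
    then show ?thesis by simp
  qed
  have "periodic a"
    unfolding periodic_def
  proof
    fix x
    have "A (x + 2 * pi) t = A x t" if "t \<in> {0..s0}" for t
      using sub that s0 by (simp add: viscosity_subsolution_def periodic_def A_def)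
    then show "a (x + 2 * pi) = a x" unfolding a_def by (intro SUP_cong) auto
  qed
  from C11_interposition[OF k this ab]
  obtain h where h: "C11 h" and ah: "\<And>x z. a x \<le> h z + 2 * k * (x - z)\<^sup>2"
    and hb: "\<And>y z. h z \<le> b y + 2 * k * (y - z)\<^sup>2" by blast
  \<comment> \<open>At the midpoint the two costs with coefficient \<open>2 * k\<close> add up to
    \<open>k * (x0 - y0)\<^sup>2\<close>, exactly the gap between \<open>A\<close> and
    \<open>B\<close>. The bounds on \<open>h\<close> from below and above therefore meet and
    determine \<open>h z\<close>.\<close>
  define z where "z = (x0 + y0) / 2"
  have zx: "2 * k * (x0 - z)\<^sup>2 = k * (x0 - y0)\<^sup>2 / 2" and zy: "2 * k * (y0 - z)\<^sup>2 = k * (x0 - y0)\<^sup>2 / 2"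
    by (simp_all add: z_def power2_eq_square field_simps)
  have A0: "A x0 s0 = f x0 s0 - \<mu> / (T - s0)" and B0: "B y0 s1 = A x0 s0 - k * (x0 - y0)\<^sup>2"
    by (simp_all add: A_def B_def M_def)
  have sq: "(x - (x + (z - x0)))\<^sup>2 = (x0 - z)\<^sup>2" for x x0 by (simp add: algebra_simps)
  have hz: "h z = A x0 s0 - k * (x0 - y0)\<^sup>2 / 2"
    using ah[of x0 z] hb[of z y0] Aa[of s0 x0] bB[of s1 y0] s0 s1 unfolding zx zy B0 by simp
  have h': "C11 (\<lambda>x. h (x + c))" for c using C11_shift(1)[OF h, of c 0] by simp
  have time: "((\<lambda>t. m / (T - t) + p * (t - s) + c * (t - s)\<^sup>2) has_real_derivative
      m / (T - t)\<^sup>2 + p + 2 * c * (t - s)) (at t)" if "t \<in> {0<..<T}" for m s c t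
    using that by (auto intro!: derivative_eq_intros simp: power2_eq_square)
  have time': "continuous_on {0<..<T} (\<lambda>t. m / (T - t)\<^sup>2 + p + 2 * c * (t - s))" for m s c
    by (intro continuous_intros) auto
  note test = test_function_separated[OF h' time time']
  define G where "G = dirichlet_neumann h h z"
  \<comment> \<open>The translate of \<open>h\<close> carries \<open>z\<close> to \<open>x0\<close>,
    and the time terms are those removed from \<open>f\<close> in \<open>A\<close>; hence
    \<open>f - \<psi>\<close> is \<open>A\<close> minus the translate of \<open>h\<close>. The test
    below uses the radius \<open>s0 / 2\<close>, which is less than \<open>s0\<close>.\<close>
  define \<psi> where "\<psi> x t = h (x + (z - x0)) + (\<mu> / (T - t) + p * (t - s0) + 2 * k * (t - s0)\<^sup>2)" for x t
  have "test_function T \<psi>" unfolding \<psi>_def by (rule test(1))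
  moreover have "f x t - \<psi> x t \<le> f x0 s0 - \<psi> x0 s0" if "t \<in> {s0 - s0 / 2..s0}" for x t
  proof -
    have "f x t - \<psi> x t = A x t - h (x + (z - x0))" by (simp add: A_def \<psi>_def)
    also have "\<dots> \<le> k * (x0 - y0)\<^sup>2 / 2"
      using Aa[of t x] ah[of x "x + (z - x0)"] that s0 unfolding sq zx by simp
    also have "\<dots> = f x0 s0 - \<psi> x0 s0" by (simp add: \<psi>_def hz A0)
    finally show ?thesis .
  qed
  ultimately have "deriv (\<psi> x0) s0 \<le> - \<kappa> * dirichlet_neumann (\<lambda>x. \<psi> x s0) (\<lambda>x. \<psi> x s0) x0"
    using sub s0 unfolding viscosity_subsolution_def
    by (metis half_gt_zero field_sum_of_halves less_add_same_cancel1)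
  moreover have "deriv (\<psi> x0) s0 = \<mu> / (T - s0)\<^sup>2 + p"
    unfolding \<psi>_def by (subst test(2)) (use s0 in auto)
  \<comment> \<open>At time \<open>s0\<close> the linear and quadratic terms vanish, so the slice is
    a translate of \<open>h\<close> plus a constant.\<close>
  moreover have "dirichlet_neumann (\<lambda>x. \<psi> x s0) (\<lambda>x. \<psi> x s0) x0 = G"
    unfolding \<psi>_def G_def using dirichlet_neumann_shift[OF h, of "z - x0" "\<mu> / (T - s0)" x0] by simp
  ultimately have 1: "\<mu> / (T - s0)\<^sup>2 + p \<le> - \<kappa> * G" by simp
  \<comment> \<open>The mirror image for \<open>g\<close>: the penalty and the quadratic term change
    sign, the slope \<open>p\<close> does not.\<close>
  define \<omega> where "\<omega> y s = h (y + (z - y0)) + ((- \<mu>) / (T - s) + p * (s - s1) + (- 2 * k) * (s - s1)\<^sup>2)" for y s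
  have "test_function T \<omega>" unfolding \<omega>_def by (rule test(1))
  moreover have "g y s - \<omega> y s \<ge> g y0 s1 - \<omega> y0 s1" if "s \<in> {s1 - s1 / 2..s1}" for y s
  proof -
    have "g y0 s1 - \<omega> y0 s1 = B y0 s1 - M - h z" by (simp add: B_def \<omega>_def)
    also have "\<dots> = - (k * (x0 - y0)\<^sup>2 / 2) - M" by (simp add: hz B0)
    also have "\<dots> \<le> B y s - M - h (y + (z - y0))"
      using bB[of s y] hb[of "y + (z - y0)" y] that s1 unfolding sq zy by simp
    also have "\<dots> = g y s - \<omega> y s" by (simp add: B_def \<omega>_def)
    finally show ?thesis .
  qed
  ultimately have "deriv (\<omega> y0) s1 \<ge> - \<kappa> * dirichlet_neumann (\<lambda>y. \<omega> y s1) (\<lambda>y. \<omega> y s1) y0"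
    using super s1 unfolding viscosity_supersolution_def
    by (metis half_gt_zero field_sum_of_halves less_add_same_cancel1)
  moreover have "deriv (\<omega> y0) s1 = - \<mu> / (T - s1)\<^sup>2 + p"
    unfolding \<omega>_def by (subst test(2)) (use s1 in auto)
  moreover have "dirichlet_neumann (\<lambda>y. \<omega> y s1) (\<lambda>y. \<omega> y s1) y0 = G"
    unfolding \<omega>_def G_def using dirichlet_neumann_shift[OF h, of "z - y0" "- \<mu> / (T - s1)" y0] by simp
  ultimately have 2: "- \<mu> / (T - s1)\<^sup>2 + p \<ge> - \<kappa> * G" by simp
  have "0 < \<mu> / (T - s0)\<^sup>2" "0 < \<mu> / (T - s1)\<^sup>2" using \<mu> s0 s1 by simp_all
  then show False using 1 2 by simp
qed


section \<open>Semicontinuity and the initial and final times\<close>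

text \<open>The punctured filter is replaced by a full neighbourhood, because the bound at
  \<open>p\<close> itself is assumed.\<close>

lemma usc_onD:
  assumes "usc_on A F" "p \<in> A" "F p < c"
  shows "\<exists>U. open U \<and> p \<in> U \<and> (\<forall>q\<in>U \<inter> A. F q < c)"
proof -
  have "eventually (\<lambda>q. F q < c) (at p within A)"
    using assms by (simp add: usc_on_def)
  then obtain U where U: "open U" "p \<in> U" "\<forall>q\<in>U. q \<noteq> p \<longrightarrow> q \<in> A \<longrightarrow> F q < c"
    unfolding eventually_at_topological by blast
  have "F q < c" if "q \<in> U \<inter> A" for q
    using U(3) that assms(3) by (cases "q = p") auto
  with U(1,2) show ?thesis by blast
qed

lemma usc_onI:
  assumes "\<And>p c. p \<in> A \<Longrightarrow> F p < c \<Longrightarrow> \<exists>U. open U \<and> p \<in> U \<and> (\<forall>q\<in>U \<inter> A. F q < c)"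
  shows "usc_on A F"
  unfolding usc_on_def eventually_at_topological using assms by (meson IntI)

lemma usc_on_uminus: assumes "lsc_on A F" shows "usc_on A (\<lambda>p. - F p)"
  unfolding usc_on_def
proof (intro ballI allI impI)
  fix p c assume "p \<in> A" "- F p < c"
  then have "eventually (\<lambda>q. - c < F q) (at p within A)"
    using assms by (simp add: lsc_on_def minus_less_iff)
  then show "eventually (\<lambda>q. - F q < c) (at p within A)"
    by (simp add: minus_less_iff)
qed

lemma usc_on_add:
  assumes F: "usc_on A F" and G: "usc_on A G"
  shows "usc_on A (\<lambda>p. F p + G p)"
proof (rule usc_onI)
  fix p c assume p: "p \<in> A" and c: "F p + G p < c"
  define e where "e = (c - F p - G p) / 2"
  have e: "F p < F p + e" "G p < G p + e" using c by (simp_all add: e_def)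
  obtain U where U: "open U" "p \<in> U" "\<forall>q\<in>U \<inter> A. F q < F p + e"
    using usc_onD[OF F p e(1)] by blast
  obtain V where V: "open V" "p \<in> V" "\<forall>q\<in>V \<inter> A. G q < G p + e"
    using usc_onD[OF G p e(2)] by blast
  have "F q + G q < c" if "q \<in> (U \<inter> V) \<inter> A" for q
  proof -
    have "F q < F p + e" "G q < G p + e" using U(3) V(3) that by blast+
    moreover have "2 * e = c - F p - G p" by (simp add: e_def)
    ultimately show ?thesis by linarith
  qed
  then show "\<exists>U. open U \<and> p \<in> U \<and> (\<forall>q\<in>U \<inter> A. F q + G q < c)"
    using U(1,2) V(1,2) by (intro exI[of _ "U \<inter> V"]) auto
qed

lemma usc_on_compose:
  assumes F: "usc_on B F" and h: "continuous_on A h" "h ` A \<subseteq> B"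
  shows "usc_on A (\<lambda>p. F (h p))"
proof (rule usc_onI)
  fix p c assume p: "p \<in> A" and c: "F (h p) < c"
  have "h p \<in> B" using p h(2) by blast
  from usc_onD[OF F this c] obtain U
    where U: "open U" "h p \<in> U" "\<forall>q\<in>U \<inter> B. F q < c" by blast
  from h(1) U(1) obtain V where V: "open V" "V \<inter> A = h -` U \<inter> A"
    unfolding continuous_on_open_invariant by blast
  have "p \<in> V" using V(2) U(2) p by blast
  moreover have "F (h q) < c" if "q \<in> V \<inter> A" for q
    using U(3) that V(2) h(2) by blast
  ultimately show "\<exists>U. open U \<and> p \<in> U \<and> (\<forall>q\<in>U \<inter> A. F (h q) < c)"
    using V(1) by blast
qed

lemma usc_on_continuous:
  fixes F :: "'a::topological_space \<Rightarrow> real"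
  assumes "continuous_on A F" shows "usc_on A F"
  unfolding usc_on_def
proof (intro ballI allI impI)
  fix p c assume "p \<in> A" "F p < c"
  from \<open>p \<in> A\<close> assms have "(F \<longlongrightarrow> F p) (at p within A)" by (simp add: continuous_on_def)
  from order_tendstoD(2)[OF this \<open>F p < c\<close>] show "\<forall>\<^sub>F q in at p within A. F q < c" .
qed

text \<open>If every \<open>p\<close> were beaten by some \<open>r p\<close>, semicontinuity would
  spread \<open>F q < F (r p)\<close> over a neighbourhood of \<open>p\<close>. In a finite subcover
  the largest of the values \<open>F (r p)\<close> would then lie strictly below one of these
  values.\<close>

lemma usc_on_attains_max:
  assumes K: "compact K" "K \<noteq> {}" and F: "usc_on K F"
  obtains p where "p \<in> K" "\<And>q. q \<in> K \<Longrightarrow> F q \<le> F p"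
proof -
  have "\<exists>p\<in>K. \<forall>q\<in>K. F q \<le> F p"
  proof (rule ccontr)
    assume "\<not> (\<exists>p\<in>K. \<forall>q\<in>K. F q \<le> F p)"
    then have "\<forall>p\<in>K. \<exists>r\<in>K. F p < F r" by (meson not_le)
    then obtain r where r: "\<And>p. p \<in> K \<Longrightarrow> r p \<in> K" "\<And>p. p \<in> K \<Longrightarrow> F p < F (r p)" by metis
    have "\<forall>p\<in>K. \<exists>U. open U \<and> p \<in> U \<and> (\<forall>q\<in>U \<inter> K. F q < F (r p))"
      using usc_onD[OF F _ r(2)] by blast
    from bchoice[OF this] obtain U
      where U: "\<And>p. p \<in> K \<Longrightarrow> open (U p) \<and> p \<in> U p \<and> (\<forall>q\<in>U p \<inter> K. F q < F (r p))" by blast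
    have "K \<subseteq> (\<Union>p\<in>K. U p)" using U by blast
    then obtain C where C: "C \<subseteq> K" "finite C" "K \<subseteq> (\<Union>p\<in>C. U p)"
      using compactE_image[OF K(1), of K U] U by blast
    have "C \<noteq> {}" using C(3) K(2) by blast
    define m where "m = Max ((\<lambda>p. F (r p)) ` C)"
    have "m \<in> (\<lambda>p. F (r p)) ` C"
      unfolding m_def using C(2) \<open>C \<noteq> {}\<close> by (intro Max_in) auto
    then obtain p where p: "p \<in> C" "m = F (r p)" by blast
    have rp: "r p \<in> K" using p(1) C(1) r(1) by blast
    then obtain p' where p': "p' \<in> C" "r p \<in> U p'" using C(3) by blast
    have "m < F (r p')" using U[of p'] p p' C(1) rp by blast
    moreover have "F (r p') \<le> m" unfolding m_def using p'(1) C(2) by (intro Max_ge) auto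
    ultimately show False by simp
  qed
  then show ?thesis using that by blast
qed

section \<open>Separation from the initial time\<close>

lemma dist_prod_le_add: "dist (x, t) (y, s) \<le> dist x y + dist t s"
  unfolding dist_Pair_Pair by (rule sqrt_sum_squares_le_sum) auto

text \<open>Semicontinuity and the initial order keep \<open>f - g\<close> below \<theta> for pairs
  of points close to a common initial point, uniformly by compactness of one period. A large
  \<open>k\<close> forces the two points together, so a value of at least \<theta> excludes time
  zero for either of them.\<close>

lemma initial_layer:
  fixes f g :: "real \<Rightarrow> real \<Rightarrow> real"
  assumes T: "0 < T" and f: "usc_on (UNIV \<times> {0..T}) (\<lambda>(x, t). f x t)"
    and g: "lsc_on (UNIV \<times> {0..T}) (\<lambda>(x, t). g x t)"
    and per: "\<And>t. t \<in> {0..T} \<Longrightarrow> periodic (\<lambda>x. f x t)" "\<And>t. t \<in> {0..T} \<Longrightarrow> periodic (\<lambda>x. g x t)"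
    and B: "\<And>x t y s. t \<in> {0..T} \<Longrightarrow> s \<in> {0..T} \<Longrightarrow> f x t - g y s \<le> B"
    and init: "\<And>x. f x 0 \<le> g x 0" and \<theta>: "0 < \<theta>"
  obtains k where "0 < k"
    "\<And>x t y s. t \<in> {0..T} \<Longrightarrow> s \<in> {0..T} \<Longrightarrow>
      \<theta> \<le> f x t - g y s - k * (x - y)\<^sup>2 - k * (t - s)\<^sup>2 \<Longrightarrow> 0 < t \<and> 0 < s"
proof -
  let ?S = "UNIV \<times> {0..T}" and ?f = "\<lambda>(x, t). f x t" and ?g = "\<lambda>(x, t). g x t"
  have "\<exists>W. open W \<and> (x, 0) \<in> W \<and> (\<forall>q\<in>W \<inter> ?S. \<forall>q'\<in>W \<inter> ?S. ?f q - ?g q' < \<theta>)" for x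
  proof -
    have x: "(x, 0) \<in> ?S" using T by simp
    obtain U where U: "open U" "(x, 0) \<in> U" "\<forall>q\<in>U \<inter> ?S. ?f q < f x 0 + \<theta> / 2"
      using usc_onD[OF f x, of "f x 0 + \<theta> / 2"] \<theta> by auto
    obtain V where V: "open V" "(x, 0) \<in> V" "\<forall>q\<in>V \<inter> ?S. - ?g q < - g x 0 + \<theta> / 2"
      using usc_onD[OF usc_on_uminus[OF g] x, of "- g x 0 + \<theta> / 2"] \<theta> by auto
    have "?f q - ?g q' < \<theta>" if "q \<in> (U \<inter> V) \<inter> ?S" "q' \<in> (U \<inter> V) \<inter> ?S" for q q'
    proof -
      have "?f q < f x 0 + \<theta> / 2" "- ?g q' < - g x 0 + \<theta> / 2" using U(3) V(3) that by blast+
      then have "?f q - ?g q' < f x 0 - g x 0 + \<theta>" by linarith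
      then show ?thesis using init[of x] by linarith
    qed
    then show ?thesis using U(1,2) V(1,2) by (intro exI[of _ "U \<inter> V"]) auto
  qed
  then obtain W where W: "\<And>x. open (W x)" "\<And>x. (x, 0) \<in> W x"
    "\<And>x q q'. q \<in> W x \<inter> ?S \<Longrightarrow> q' \<in> W x \<inter> ?S \<Longrightarrow> ?f q - ?g q' < \<theta>" by metis
  have cpt: "compact ({0..2 * pi} \<times> {0 :: real})" by (intro compact_Times) auto
  have cover: "{0..2 * pi} \<times> {0} \<subseteq> \<Union> (range W)" using W(2) by blast
  \<comment> \<open>A Lebesgue number of the cover: one radius for all initial points of a
    period.\<close>
  obtain e where e: "0 < e" and
    ball: "\<And>p. p \<in> {0..2 * pi} \<times> {0} \<Longrightarrow> \<exists>G\<in>range W. ball p e \<subseteq> G"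
    using Heine_Borel_lemma[OF cpt cover] W(1) by blast
  have near: "f y t - g y' t' < \<theta>"
    if ty: "t \<in> {0..T}" "t' \<in> {0..T}" "\<bar>x - y\<bar> + t < e" "\<bar>x - y'\<bar> + t' < e" for x y t y' t'
  proof -
    obtain b where b: "0 \<le> b" "b \<le> 2 * pi"
      and eq: "\<And>(u :: real \<Rightarrow> real) z. periodic u \<Longrightarrow> u (z + x) = u (z + b)"
      using periodic_reduce[of x] by blast
    have *: "f y t = f (y - x + b) t" "g y' t' = g (y' - x + b) t'"
      using eq[OF per(1)[OF ty(1)], of "y - x"] eq[OF per(2)[OF ty(2)], of "y' - x"] by simp_all
    obtain x' where x': "ball (b, 0) e \<subseteq> W x'" using ball[of "(b, 0)"] b by auto
    have "(y - x + b, t) \<in> ball (b, 0) e" "(y' - x + b, t') \<in> ball (b, 0) e"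
      using dist_prod_le_add[of b 0 "y - x + b" t] dist_prod_le_add[of b 0 "y' - x + b" t'] ty
      by (auto simp: dist_real_def)
    then have "?f (y - x + b, t) - ?g (y' - x + b, t') < \<theta>"
      using x' ty(1,2) by (intro W(3)[of _ x']) auto
    then show ?thesis using * by simp
  qed
  \<comment> \<open>Then \<open>k * (e / 2)\<^sup>2\<close> is \<open>\<bar>B\<bar> + 1\<close>,
    which exceeds \<open>B\<close>.\<close>
  define k where "k = 4 * (\<bar>B\<bar> + 1) / e\<^sup>2"
  have k: "k > 0" using e by (simp add: k_def)
  have small: "\<bar>d\<bar> < e / 2" if "k * d\<^sup>2 \<le> B" for d
  proof (rule ccontr)
    assume "\<not> \<bar>d\<bar> < e / 2"
    then have "(e / 2)\<^sup>2 \<le> d\<^sup>2" using e by (intro abs_le_square_iff[THEN iffD1]) simp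
    from mult_left_mono[OF this less_imp_le[OF k]] have "k * (e / 2)\<^sup>2 \<le> B" using that by linarith
    moreover have "k * (e / 2)\<^sup>2 = \<bar>B\<bar> + 1" using e by (simp add: k_def power2_eq_square)
    ultimately show False by simp
  qed
  have "0 < t \<and> 0 < s" if ts: "t \<in> {0..T}" "s \<in> {0..T}"
    and large: "\<theta> \<le> f x t - g y s - k * (x - y)\<^sup>2 - k * (t - s)\<^sup>2" for x t y s
  proof (rule ccontr)
    assume "\<not> (0 < t \<and> 0 < s)"
    then have "t = 0 \<or> s = 0" using ts by auto
    have nn: "0 \<le> k * (x - y)\<^sup>2" "0 \<le> k * (t - s)\<^sup>2" using k by simp_all
    have "k * (x - y)\<^sup>2 \<le> B" "k * (t - s)\<^sup>2 \<le> B"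
      using B[OF ts, of x y] large nn \<theta> by linarith+
    then have close: "\<bar>x - y\<bar> < e / 2" "\<bar>t - s\<bar> < e / 2" using small by blast+
    \<comment> \<open>The ball is centred at the spatial position of the point at time zero; the
      other point is less than \<open>e / 2\<close> away in space and also in time.\<close>
    have "f x t - g y s < \<theta>"
      using \<open>t = 0 \<or> s = 0\<close>
    proof
      assume "t = 0" then show ?thesis using near[of t s x x y] ts close e by simp
    next
      assume "s = 0" then show ?thesis using near[of t s y x y] ts close e by (simp add: abs_minus_commute)
    qed
    then show False using large nn by linarith
  qed
  with k show ?thesis by (rule that)
qed

section \<open>Approximation of final values from earlier times\<close>

lemma final_value_sub_approx:
  assumes F: "final_value_sub T f x" and c: "c < f x T" and e: "0 < e"
  obtains y s where "0 \<le> s" "s < T" "\<bar>y - x\<bar> < e" "\<bar>s - T\<bar> < e" "c < f y s"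
proof -
  have "\<exists>p\<in>UNIV \<times> {0..<T}. dist p (x, T) < e \<and> c < f (fst p) (snd p)"
  proof (rule ccontr)
    assume n: "\<not> ?thesis"
    \<comment> \<open>Without such a point \<open>c\<close> would bound \<open>f\<close> at all
      nearby earlier times, and the limit superior could not reach \<open>f x T\<close>.\<close>
    have "eventually (\<lambda>p. (\<lambda>(y, t). ereal (f y t)) p \<le> ereal c) (at (x, T) within UNIV \<times> {0..<T})"
      unfolding eventually_at using n e by (intro exI[of _ e]) force
    then have "Limsup (at (x, T) within UNIV \<times> {0..<T}) (\<lambda>(y, t). ereal (f y t)) \<le> ereal c"
      by (rule Limsup_bounded)
    then show False using F c unfolding final_value_sub_def by (meson ereal_less_eq(3) leD order_trans)
  qed
  then obtain y s where "0 \<le> s" "s < T" "dist (y, s) (x, T) < e" "c < f y s" by auto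
  moreover have "\<bar>y - x\<bar> \<le> dist (y, s) (x, T)" "\<bar>s - T\<bar> \<le> dist (y, s) (x, T)"
    using dist_fst_le[of "(y, s)" "(x, T)"] dist_snd_le[of "(y, s)" "(x, T)"] by (simp_all add: dist_real_def)
  ultimately show ?thesis using that[of s y] by linarith
qed

lemma final_value_super_approx:
  assumes G: "final_value_super T g x" and c: "g x T < c" and e: "0 < e"
  obtains y s where "0 \<le> s" "s < T" "\<bar>y - x\<bar> < e" "\<bar>s - T\<bar> < e" "g y s < c"
proof -
  have "\<exists>p\<in>UNIV \<times> {0..<T}. dist p (x, T) < e \<and> g (fst p) (snd p) < c"
  proof (rule ccontr)
    assume n: "\<not> ?thesis"
    have "eventually (\<lambda>p. ereal c \<le> (\<lambda>(y, t). ereal (g y t)) p) (at (x, T) within UNIV \<times> {0..<T})"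
      unfolding eventually_at using n e by (intro exI[of _ e]) force
    then have "ereal c \<le> Liminf (at (x, T) within UNIV \<times> {0..<T}) (\<lambda>(y, t). ereal (g y t))"
      by (rule Liminf_bounded)
    then show False using G c unfolding final_value_super_def by (meson ereal_less_eq(3) leD order_trans)
  qed
  then obtain y s where "0 \<le> s" "s < T" "dist (y, s) (x, T) < e" "g y s < c" by auto
  moreover have "\<bar>y - x\<bar> \<le> dist (y, s) (x, T)" "\<bar>s - T\<bar> \<le> dist (y, s) (x, T)"
    using dist_fst_le[of "(y, s)" "(x, T)"] dist_snd_le[of "(y, s)" "(x, T)"] by (simp_all add: dist_real_def)
  ultimately show ?thesis using that[of s y] by linarith
qed


section \<open>The comparison principle\<close>

theorem theorem6p3:
  fixes \<kappa> T :: real and f g :: "real \<Rightarrow> real \<Rightarrow> real"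
  assumes "\<kappa> > 0" and "T > 0"
    and "viscosity_subsolution \<kappa> T f"
    and "bounded ((\<lambda>(x, t). f x t) ` (UNIV \<times> {0..T}))"
    and "viscosity_supersolution \<kappa> T g"
    and "bounded ((\<lambda>(x, t). g x t) ` (UNIV \<times> {0..T}))"
    and "\<forall>x. f x 0 \<le> g x 0"
  shows "\<forall>x. \<forall>t\<in>{0..T}.
    (t = T \<longrightarrow> final_value_sub T f x \<and> final_value_super T g x) \<longrightarrow> f x t \<le> g x t"
proof (intro allI ballI impI)
  fix x t
  assume t: "t \<in> {0..T}" and fin: "t = T \<longrightarrow> final_value_sub T f x \<and> final_value_super T g x"
  have T: "0 < T" by fact
  have fper: "\<And>t. t \<in> {0..T} \<Longrightarrow> periodic (\<lambda>x. f x t)"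
    and fusc: "usc_on (UNIV \<times> {0..T}) (\<lambda>(x, t). f x t)"
    using assms(3) by (simp_all add: viscosity_subsolution_def)
  have gper: "\<And>t. t \<in> {0..T} \<Longrightarrow> periodic (\<lambda>x. g x t)"
    and glsc: "lsc_on (UNIV \<times> {0..T}) (\<lambda>(x, t). g x t)"
    using assms(5) by (simp_all add: viscosity_supersolution_def)
  obtain Bf where Bf: "\<And>x t. t \<in> {0..T} \<Longrightarrow> \<bar>f x t\<bar> \<le> Bf"
    using assms(4) unfolding bounded_iff by fastforce
  obtain Bg where Bg: "\<And>x t. t \<in> {0..T} \<Longrightarrow> \<bar>g x t\<bar> \<le> Bg"
    using assms(6) unfolding bounded_iff by fastforce
  define B where "B = Bf + Bg"
  have B: "f x t - g y s \<le> B" if "t \<in> {0..T}" "s \<in> {0..T}" for x t y s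
    using Bf[OF that(1), of x] Bg[OF that(2), of y] unfolding B_def by linarith
  have B0: "0 \<le> B"
    using Bf[of 0 0] Bg[of 0 0] T unfolding B_def by fastforce
  show "f x t \<le> g x t"
  proof (rule ccontr)
    assume neg: "\<not> f x t \<le> g x t"
    \<comment> \<open>One third of the violation is reserved for moving away from the final time,
      one for the penalties, and the last remains as the positive threshold of the maximum.\<close>
    define \<theta> where "\<theta> = (f x t - g x t) / 3"
    have \<theta>: "0 < \<theta>" using neg by (simp add: \<theta>_def)
    obtain k where k: "0 < k" and layer: "\<And>x t y s. t \<in> {0..T} \<Longrightarrow> s \<in> {0..T} \<Longrightarrow>
        \<theta> \<le> f x t - g y s - k * (x - y)\<^sup>2 - k * (t - s)\<^sup>2 \<Longrightarrow> 0 < t \<and> 0 < s"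
      using initial_layer[OF T fusc glsc fper gper B _ \<theta>] assms(7) by blast
    have "\<exists>x1 t1 y1 s1. 0 \<le> t1 \<and> t1 < T \<and> 0 \<le> s1 \<and> s1 < T \<and>
        2 * \<theta> \<le> f x1 t1 - g y1 s1 - k * (x1 - y1)\<^sup>2 - k * (t1 - s1)\<^sup>2"
    proof (cases "t = T")
      case False
      then show ?thesis using t \<theta>
        by (intro exI[of _ x] exI[of _ t]) (auto simp: \<theta>_def)
    next
      case True
      \<comment> \<open>With this radius \<open>k * (2 * e)\<^sup>2\<close> is
        \<open>\<theta> / 4\<close>. The two approximations and the two quadratic terms then lose at
        most \<theta> altogether.\<close>
      define e where "e = sqrt (\<theta> / (16 * k))"
      have e: "0 < e" using \<theta> k by (simp add: e_def)
      have fs: "final_value_sub T f x" and gs: "final_value_super T g x" using fin True by auto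
      have lt: "f x T - \<theta> / 4 < f x T" "g x T < g x T + \<theta> / 4" using \<theta> by simp_all
      obtain x1 t1 where 1: "0 \<le> t1" "t1 < T" "\<bar>x1 - x\<bar> < e" "\<bar>t1 - T\<bar> < e" "f x T - \<theta> / 4 < f x1 t1"
        using final_value_sub_approx[OF fs lt(1) e] by blast
      obtain y1 s1 where 2: "0 \<le> s1" "s1 < T" "\<bar>y1 - x\<bar> < e" "\<bar>s1 - T\<bar> < e" "g y1 s1 < g x T + \<theta> / 4"
        using final_value_super_approx[OF gs lt(2) e] by blast
      have sq: "k * d\<^sup>2 \<le> \<theta> / 4" if "\<bar>d\<bar> \<le> 2 * e" for d
      proof -
        have "d\<^sup>2 \<le> (2 * e)\<^sup>2" using that e by (intro abs_le_square_iff[THEN iffD1]) simp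
        also have "\<dots> = \<theta> / (4 * k)" using \<theta> k by (simp add: e_def power_mult_distrib)
        finally show ?thesis using k by (simp add: field_simps)
      qed
      have "k * (x1 - y1)\<^sup>2 \<le> \<theta> / 4" "k * (t1 - s1)\<^sup>2 \<le> \<theta> / 4"
        using 1 2 by (intro sq; linarith)+
      moreover have "f x T - g x T = 3 * \<theta>" using True by (simp add: \<theta>_def)
      ultimately have "2 * \<theta> \<le> f x1 t1 - g y1 s1 - k * (x1 - y1)\<^sup>2 - k * (t1 - s1)\<^sup>2"
        using 1 2 by linarith
      then show ?thesis using 1 2 by blast
    qed
    then obtain x1 t1 y1 s1 where 1: "0 \<le> t1" "t1 < T" "0 \<le> s1" "s1 < T"
      and large: "2 * \<theta> \<le> f x1 t1 - g y1 s1 - k * (x1 - y1)\<^sup>2 - k * (t1 - s1)\<^sup>2" by blast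
    define m where "m = min (T - t1) (T - s1)"
    have m: "0 < m" "m \<le> T - t1" "m \<le> T - s1" using 1 by (auto simp: m_def)
    \<comment> \<open>Small enough that each penalty costs at most \<open>\<theta> / 2\<close> at
      the starting point.\<close>
    define \<mu> where "\<mu> = \<theta> * m / 2"
    have \<mu>: "0 < \<mu>" using \<theta> m(1) by (simp add: \<mu>_def)
    define \<Phi> where "\<Phi> = (\<lambda>((x, t), (y, s)).
      f x t - \<mu> / (T - t) - (g y s + \<mu> / (T - s)) - k * (x - y)\<^sup>2 - k * (t - s)\<^sup>2)"
    have "\<mu> / (T - t1) \<le> \<theta> / 2" "\<mu> / (T - s1) \<le> \<theta> / 2"
      using \<theta> 1 m by (simp_all add: \<mu>_def divide_le_eq)
    then have start: "\<theta> \<le> \<Phi> ((x1, t1), (y1, s1))"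
      using large by (simp add: \<Phi>_def)
    \<comment> \<open>A value of at least \<theta> forces both penalties and
      \<open>k * (x - y)\<^sup>2\<close> below \<open>B\<close>, which confines the times to
      \<open>{0..\<rho>}\<close> and \<open>x - y\<close> to size \<open>R\<close>. The added 1
      covers \<open>B = 0\<close> in \<rho>, and gives \<open>1 \<le> R\<close>, hence
      \<open>R \<le> R\<^sup>2\<close>.\<close>
    define \<rho> where "\<rho> = T - \<mu> / (B + 1)"
    define R where "R = B / k + 1"
    define C where "C = ({0..2 * pi} \<times> {0..\<rho>}) \<times> ({- R..2 * pi + R} \<times> {0..\<rho>})"
    have \<rho>: "\<rho> < T" using \<mu> B0 by (simp add: \<rho>_def)
    have late: "t \<le> \<rho>" if "t < T" "\<mu> / (T - t) \<le> B" for t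
    proof -
      have "\<mu> \<le> B * (T - t)" using that by (simp add: divide_le_eq)
      also have "\<dots> \<le> (B + 1) * (T - t)" using that by simp
      finally show ?thesis using B0 by (simp add: \<rho>_def field_simps)
    qed
    have in_C: "((x, t), (y, s)) \<in> C"
      if ts: "0 \<le> t" "t < T" "0 \<le> s" "s < T" and x: "0 \<le> x" "x \<le> 2 * pi"
        and \<Phi>: "\<theta> \<le> \<Phi> ((x, t), (y, s))" for x t y s
    proof -
      have nn: "0 \<le> k * (x - y)\<^sup>2" "0 \<le> k * (t - s)\<^sup>2" "0 \<le> \<mu> / (T - t)" "0 \<le> \<mu> / (T - s)"
        using k \<mu> ts by simp_all
      moreover have "\<theta> \<le> f x t - \<mu> / (T - t) - (g y s + \<mu> / (T - s)) - k * (x - y)\<^sup>2 - k * (t - s)\<^sup>2"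
        using \<Phi> by (simp add: \<Phi>_def)
      moreover have "f x t - g y s \<le> B" using ts by (intro B) auto
      ultimately have "\<mu> / (T - t) \<le> B" "\<mu> / (T - s) \<le> B" and xy: "k * (x - y)\<^sup>2 \<le> B"
        using \<theta> by linarith+
      then have "t \<le> \<rho>" "s \<le> \<rho>" using late ts by blast+
      moreover have "\<bar>x - y\<bar> \<le> R"
      proof (rule ccontr)
        assume "\<not> \<bar>x - y\<bar> \<le> R"
        moreover have R: "1 \<le> R" using B0 k by (simp add: R_def)
        ultimately have "R\<^sup>2 \<le> (x - y)\<^sup>2" by (intro abs_le_square_iff[THEN iffD1]) simp
        moreover have "R \<le> R\<^sup>2" using R by (simp add: power2_eq_square)
        ultimately have "k * R \<le> k * (x - y)\<^sup>2" using k by simp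
        moreover have "k * R = B + k" using k by (simp add: R_def field_simps)
        ultimately show False using xy k by simp
      qed
      ultimately show ?thesis using ts x by (auto simp: C_def)
    qed
    \<comment> \<open>A common translation of \<open>x\<close> and \<open>y\<close> preserves their
      difference, so \<open>x\<close> can be brought into one period without changing
      \<Phi>.\<close>
    have shift: "\<exists>x' y'. 0 \<le> x' \<and> x' \<le> 2 * pi \<and> \<Phi> ((x', t), (y', s)) = \<Phi> ((x, t), (y, s))"
      if ts: "0 \<le> t" "t < T" "0 \<le> s" "s < T" for x t y s
    proof -
      obtain b where b: "0 \<le> b" "b \<le> 2 * pi"
        and eq: "\<And>(u :: real \<Rightarrow> real) z. periodic u \<Longrightarrow> u (z + x) = u (z + b)"
        using periodic_reduce[of x] by blast
      have "f x t = f b t" using eq[OF fper[of t], of 0] ts by simp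
      moreover have "g y s = g (y - x + b) s" using eq[OF gper[of s], of "y - x"] ts by simp
      ultimately have "\<Phi> ((b, t), (y - x + b, s)) = \<Phi> ((x, t), (y, s))"
        by (simp add: \<Phi>_def algebra_simps)
      with b show ?thesis by blast
    qed
    obtain x1' y1' where start': "0 \<le> x1'" "x1' \<le> 2 * pi" "\<theta> \<le> \<Phi> ((x1', t1), (y1', s1))"
      using shift[OF 1, of x1 y1] start by metis
    have ne: "((x1', t1), (y1', s1)) \<in> C" by (rule in_C[OF 1 start'])
    have "compact C" unfolding C_def by (intro compact_Times compact_Icc)
    \<comment> \<open>The penalties are continuous on \<open>C\<close>, where all times are at most
      \<rho> and hence less than \<open>T\<close>.\<close>
    have usc: "usc_on C \<Phi>"
    proof -
      let ?r = "\<lambda>p. - \<mu> / (T - snd (fst p)) - \<mu> / (T - snd (snd p)) - k * (fst (fst p) - fst (snd p))\<^sup>2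
          - k * (snd (fst p) - snd (snd p))\<^sup>2"
      have \<Phi>_eq: "\<Phi> = (\<lambda>p. ((case fst p of (x, t) \<Rightarrow> f x t) + - (case snd p of (x, t) \<Rightarrow> g x t)) + ?r p)"
        by (auto simp: \<Phi>_def fun_eq_iff)
      have "usc_on C (\<lambda>p. case fst p of (x, t) \<Rightarrow> f x t)"
        by (rule usc_on_compose[OF fusc]) (use \<rho> in \<open>auto simp: C_def intro: continuous_on_fst continuous_on_id\<close>)
      moreover have "usc_on C (\<lambda>p. - (case snd p of (x, t) \<Rightarrow> g x t))"
        by (rule usc_on_compose[OF usc_on_uminus[OF glsc]])
          (use \<rho> in \<open>auto simp: C_def intro: continuous_on_snd continuous_on_id\<close>)
      moreover have "usc_on C ?r"
        using \<rho> by (intro usc_on_continuous continuous_intros) (auto simp: C_def)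
      ultimately show ?thesis
        unfolding \<Phi>_eq by (intro usc_on_add)
    qed
    obtain p where p: "p \<in> C" and p_max: "\<And>q. q \<in> C \<Longrightarrow> \<Phi> q \<le> \<Phi> p"
      using usc_on_attains_max[OF \<open>compact C\<close> _ usc] ne by blast
    obtain x0 s0 y0 s1' where p_eq: "p = ((x0, s0), (y0, s1'))" by (metis surj_pair)
    have s: "0 \<le> s0" "s0 < T" "0 \<le> s1'" "s1' < T" using p \<rho> by (auto simp: C_def p_eq)
    have p_large: "\<theta> \<le> \<Phi> p" using p_max[OF ne] start'(3) by simp
    have "0 \<le> \<mu> / (T - s0)" "0 \<le> \<mu> / (T - s1')" using \<mu> s by simp_all
    then have "\<theta> \<le> f x0 s0 - g y0 s1' - k * (x0 - y0)\<^sup>2 - k * (s0 - s1')\<^sup>2"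
      using p_large by (simp add: p_eq \<Phi>_def)
    then have pos: "0 < s0 \<and> 0 < s1'" using s by (intro layer) auto
    \<comment> \<open>The maximum over \<open>C\<close> is global for times before \<open>T\<close>:
      pairs with value at least \<theta> can be shifted into \<open>C\<close>, and all others lie
      below the maximum anyway.\<close>
    have "\<Phi> ((x, t), (y, s)) \<le> \<Phi> p" if ts: "0 \<le> t" "t < T" "0 \<le> s" "s < T" for x t y s
    proof -
      obtain x' y' where x': "0 \<le> x'" "x' \<le> 2 * pi" "\<Phi> ((x', t), (y', s)) = \<Phi> ((x, t), (y, s))"
        using shift[OF ts, of x y] by blast
      show ?thesis
      proof (cases "\<theta> \<le> \<Phi> ((x', t), (y', s))")
        case True
        from p_max[OF in_C[OF ts x'(1,2) True]] show ?thesis by (simp add: x'(3))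
      next
        case False
        then show ?thesis using p_large x'(3) by simp
      qed
    qed
    then have "f x t - \<mu> / (T - t) - (g y s + \<mu> / (T - s)) - k * (x - y)\<^sup>2 - k * (t - s)\<^sup>2 \<le>
        f x0 s0 - \<mu> / (T - s0) - (g y0 s1' + \<mu> / (T - s1')) - k * (x0 - y0)\<^sup>2 - k * (s0 - s1')\<^sup>2"
      if "0 \<le> t" "t < T" "0 \<le> s" "s < T" for x t y s
      using that unfolding p_eq \<Phi>_def by fastforce
    then show False
      using no_interior_maximum[OF assms(3,5) \<mu> _ _ s(2) _ s(4)] k pos by (metis less_imp_le)
  qed
qed

end
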